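(* Let $-\infty<a<b<+\infty$. Then $\mathrm{BVC}\,]a,b[ \;=\; \mathrm{BVL}^1\,]a,b[$; that is, a function $f\in L^1\,]a,b[$ is of bounded variation in the sense of Cesari if and only if its distributional derivative is represented by a finite signed Radon measure in $]a,b[$.
   Context: Notation: $]a,b[$ is the open interval; all functions are real valued, and "almost everywhere" and "measure 0" refer to Lebesgue measure. $\mathrm{BVC}\,]a,b[$: For a subset $M\subset\,]a,b[$ of Lebesgue measure $0$ (possibly empty) and $f:\,]a,b[\,\to\mathbb{R}$, let $f_M$ be the restriction of $f$ to $]a,b[\,-M$ and put $$T_{f_M}\,]a,b[\;=\;\sup\sum_{i=1}^n |f(x_i)-f(x_{i-1})|,$$ where the supremum is over all finite sequences $x_0<x_1<\cdots<x_n$ of points of $]a,b[\,-M$. A function $f\in L^1\,]a,b[$ is of bounded variation in the sense of Cesari if there exists a subset $M\subset\,]a,b[$ of Lebesgue measure $0$ such that $T_{f_M}\,]a,b[\,<+\infty$. $\mathrm{BVC}\,]a,b[$ is the set of all such $f$. $\mathrm{BVL}^1\,]a,b[$: the set of $f\in L^1\,]a,b[$ for which there is a finite signed Radon measure $Df$ in $]a,b[$ (so the total variation satisfies $|Df|(]a,b[)<+\infty$) such that $$\int_{]a,b[} f\,\phi'\,dx\;=\;-\int_{]a,b[}\phi\,d(Df)\qquad\text{for all }\phi\in C_c^\infty\,]a,b[ .$$ *)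

theory Defs
  imports "HOL-Analysis.Analysis"
begin

subsection \<open>Bounded variation in the sense of Cesari\<close>

text \<open>
  Functions on the open interval are rendered as functions on the reals; only their
  values in \<open>{a<..<b}\<close> matter in the definitions below. Elements of \<open>BVC\<close> and \<open>BVL1\<close> are
  functions, not classes modulo almost everywhere equality.
\<close>

definition variation_on :: "(real \<Rightarrow> real) \<Rightarrow> real set \<Rightarrow> ennreal" where
  "variation_on f S =
     (SUP (n, x) \<in> {(n :: nat, x :: nat \<Rightarrow> real). (\<forall>i\<le>n. x i \<in> S) \<and> (\<forall>i<n. x i < x (Suc i))}.
        ennreal (\<Sum>i=1..n. \<bar>f (x i) - f (x (i - 1))\<bar>))"

definition BVC :: "real \<Rightarrow> real \<Rightarrow> (real \<Rightarrow> real) set" where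
  "BVC a b =
     {f. set_integrable lebesgue {a<..<b} f \<and>
         (\<exists>M \<subseteq> {a<..<b}. M \<in> null_sets lebesgue \<and> variation_on f ({a<..<b} - M) < \<infinity>)}"

subsection \<open>Finite signed Radon measures\<close>

text \<open>
  Below, a measure \<open>M\<close> only serves to supply the measurable space \<open>(space M, sets M)\<close>.
  Signed measures are real-valued, hence finite.
\<close>

definition signed_measure :: "'a measure \<Rightarrow> ('a set \<Rightarrow> real) \<Rightarrow> bool" where
  "signed_measure M \<nu> \<longleftrightarrow>
     \<nu> {} = 0 \<and>
     (\<forall>A :: nat \<Rightarrow> 'a set. range A \<subseteq> sets M \<longrightarrow> disjoint_family A \<longrightarrow>
        (\<lambda>i. \<nu> (A i)) sums \<nu> (\<Union>i. A i))"

text \<open>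
  The upper and lower variations are the positive and negative parts of the Jordan
  decomposition. The coercion \<open>ennreal\<close> sends negative numbers to \<open>0\<close>, which does not affect
  the supremum because \<open>B = {}\<close> is allowed.
\<close>

definition upper_variation :: "'a measure \<Rightarrow> ('a set \<Rightarrow> real) \<Rightarrow> 'a set \<Rightarrow> ennreal" where
  "upper_variation M \<nu> A = (SUP B \<in> {B \<in> sets M. B \<subseteq> A}. ennreal (\<nu> B))"

definition lower_variation :: "'a measure \<Rightarrow> ('a set \<Rightarrow> real) \<Rightarrow> 'a set \<Rightarrow> ennreal" where
  "lower_variation M \<nu> = upper_variation M (\<lambda>B. - \<nu> B)"

definition total_variation :: "'a measure \<Rightarrow> ('a set \<Rightarrow> real) \<Rightarrow> 'a set \<Rightarrow> ennreal" where
  "total_variation M \<nu> A = upper_variation M \<nu> A + lower_variation M \<nu> A"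

definition pos_part_measure :: "'a measure \<Rightarrow> ('a set \<Rightarrow> real) \<Rightarrow> 'a measure" where
  "pos_part_measure M \<nu> = measure_of (space M) (sets M) (upper_variation M \<nu>)"

definition neg_part_measure :: "'a measure \<Rightarrow> ('a set \<Rightarrow> real) \<Rightarrow> 'a measure" where
  "neg_part_measure M \<nu> = measure_of (space M) (sets M) (lower_variation M \<nu>)"

definition signed_integral :: "'a measure \<Rightarrow> ('a set \<Rightarrow> real) \<Rightarrow> ('a \<Rightarrow> real) \<Rightarrow> real" where
  "signed_integral M \<nu> g =
     (\<integral>x. g x \<partial>pos_part_measure M \<nu>) - (\<integral>x. g x \<partial>neg_part_measure M \<nu>)"

abbreviation borel_interval :: "real \<Rightarrow> real \<Rightarrow> real measure" where
  "borel_interval a b \<equiv> restrict_space borel {a<..<b}"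

text \<open>
  The Radon condition is inner regularity of the total variation; local finiteness is implied
  by finiteness.
\<close>

definition finite_signed_radon_measure :: "real \<Rightarrow> real \<Rightarrow> (real set \<Rightarrow> real) \<Rightarrow> bool" where
  "finite_signed_radon_measure a b \<nu> \<longleftrightarrow>
     signed_measure (borel_interval a b) \<nu> \<and>
     total_variation (borel_interval a b) \<nu> {a<..<b} < \<infinity> \<and>
     (\<forall>A \<in> sets (borel_interval a b).
        total_variation (borel_interval a b) \<nu> A =
          (SUP K \<in> {K. compact K \<and> K \<subseteq> A}. total_variation (borel_interval a b) \<nu> K))"

subsection \<open>Distributional derivatives\<close>

text \<open>Test functions are extended by zero to the whole real line.\<close>

definition test_function :: "real \<Rightarrow> real \<Rightarrow> (real \<Rightarrow> real) \<Rightarrow> bool" where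
  "test_function a b \<phi> \<longleftrightarrow>
     (\<forall>n x. ((deriv ^^ n) \<phi>) differentiable (at x)) \<and>
     compact (closure {x. \<phi> x \<noteq> 0}) \<and> closure {x. \<phi> x \<noteq> 0} \<subseteq> {a<..<b}"

definition BVL1 :: "real \<Rightarrow> real \<Rightarrow> (real \<Rightarrow> real) set" where
  "BVL1 a b =
     {f. set_integrable lebesgue {a<..<b} f \<and>
         (\<exists>Df. finite_signed_radon_measure a b Df \<and>
            (\<forall>\<phi>. test_function a b \<phi> \<longrightarrow>
               (LINT x:{a<..<b}|lebesgue. f x * deriv \<phi> x)
                 = - signed_integral (borel_interval a b) Df \<phi>))}"

subsection \<open>The parts of the Jordan decomposition are measures\<close>

text \<open>
  \<open>measure_of\<close> yields the zero measure on set functions that are not countably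
  additive; the following facts show that this does not happen here.
\<close>

lemma signed_measure_add:
  assumes "signed_measure M \<nu>" "A \<in> sets M" "B \<in> sets M" "A \<inter> B = {}"
  shows "\<nu> (A \<union> B) = \<nu> A + \<nu> B"
proof -
  have "range (binaryset A B) \<subseteq> sets M" "disjoint_family (binaryset A B)"
    using assms by (auto simp: range_binaryset_eq disjoint_family_on_def binaryset_def)
  then have 1: "(\<lambda>i. \<nu> (binaryset A B i)) sums \<nu> (A \<union> B)"
    using assms(1) unfolding signed_measure_def by (metis UN_binaryset_eq)
  have "(\<lambda>i. \<nu> (binaryset A B i)) sums (\<Sum>i<2. \<nu> (binaryset A B i))"
    using assms(1) by (intro sums_finite) (auto simp: binaryset_def signed_measure_def)
  with 1 show ?thesis
    by (auto simp: binaryset_def numeral_2_eq_2 dest: sums_unique2)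
qed

lemma signed_measure_uminus:
  "signed_measure M \<nu> \<Longrightarrow> signed_measure M (\<lambda>B. - \<nu> B)"
  unfolding signed_measure_def by (auto intro: sums_minus)

lemma upper_variation_mono: "A \<subseteq> B \<Longrightarrow> upper_variation M \<nu> A \<le> upper_variation M \<nu> B"
  unfolding upper_variation_def by (intro SUP_subset_mono) auto

lemma upper_variation_upper:
  "B \<in> sets M \<Longrightarrow> B \<subseteq> A \<Longrightarrow> ennreal (\<nu> B) \<le> upper_variation M \<nu> A"
  unfolding upper_variation_def by (intro SUP_upper) auto

lemma upper_variation_superadd:
  assumes sm: "signed_measure M \<nu>" and disj: "A \<inter> B = {}"
  shows "upper_variation M \<nu> A + upper_variation M \<nu> B \<le> upper_variation M \<nu> (A \<union> B)"
proof -
  have le: "ennreal (\<nu> E) + ennreal (\<nu> F) \<le> upper_variation M \<nu> (A \<union> B)"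
    if E: "E \<in> sets M" "E \<subseteq> A" and F: "F \<in> sets M" "F \<subseteq> B" for E F
  proof (cases "\<nu> E \<ge> 0 \<and> \<nu> F \<ge> 0")
    case True
    have "E \<inter> F = {}" using E F disj by auto
    then have "ennreal (\<nu> E) + ennreal (\<nu> F) = ennreal (\<nu> (E \<union> F))"
      using True by (simp add: signed_measure_add[OF sm E(1) F(1)] ennreal_plus)
    also have "\<dots> \<le> upper_variation M \<nu> (A \<union> B)"
      using E F by (intro upper_variation_upper) auto
    finally show ?thesis .
  next
    case False
    then have "ennreal (\<nu> E) = 0 \<or> ennreal (\<nu> F) = 0" by (auto simp: ennreal_eq_0_iff)
    moreover have "ennreal (\<nu> E) \<le> upper_variation M \<nu> (A \<union> B)"
      "ennreal (\<nu> F) \<le> upper_variation M \<nu> (A \<union> B)"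
      using E F by (auto intro!: upper_variation_upper)
    ultimately show ?thesis by auto
  qed
  have ne: "{E \<in> sets M. E \<subseteq> C} \<noteq> {}" for C by blast
  have "upper_variation M \<nu> A + upper_variation M \<nu> B =
      (SUP F\<in>{F \<in> sets M. F \<subseteq> B}. upper_variation M \<nu> A + ennreal (\<nu> F))"
    unfolding upper_variation_def[of M \<nu> B] by (rule ennreal_SUP_add_right[OF ne])
  also have "\<dots> =
      (SUP F\<in>{F \<in> sets M. F \<subseteq> B}. SUP E\<in>{E \<in> sets M. E \<subseteq> A}. ennreal (\<nu> E) + ennreal (\<nu> F))"
    unfolding upper_variation_def[of M \<nu> A]
    by (intro SUP_cong refl ennreal_SUP_add_left[OF ne, symmetric])
  also have "\<dots> \<le> upper_variation M \<nu> (A \<union> B)"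
    using le by (intro SUP_least) auto
  finally show ?thesis .
qed

lemma upper_variation_empty: "signed_measure M \<nu> \<Longrightarrow> upper_variation M \<nu> {} = 0"
proof -
  assume "signed_measure M \<nu>"
  moreover have "{B \<in> sets M. B \<subseteq> {}} = {{}}" by auto
  ultimately show ?thesis unfolding upper_variation_def signed_measure_def by simp
qed

lemma countably_additive_upper_variation:
  assumes sm: "signed_measure M \<nu>"
  shows "countably_additive (sets M) (upper_variation M \<nu>)"
  unfolding countably_additive_def
proof (intro allI impI antisym)
  fix A :: "nat \<Rightarrow> 'a set"
  assume A: "range A \<subseteq> sets M" "disjoint_family A" "\<Union> (range A) \<in> sets M"
  have fin: "(\<Sum>i<n. upper_variation M \<nu> (A i)) \<le> upper_variation M \<nu> (\<Union>i<n. A i)" for n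
  proof (induction n)
    case 0
    then show ?case by simp
  next
    case (Suc n)
    have "(\<Sum>i<Suc n. upper_variation M \<nu> (A i))
        \<le> upper_variation M \<nu> (\<Union>i<n. A i) + upper_variation M \<nu> (A n)"
      using Suc by (simp add: add_right_mono)
    also have "\<dots> \<le> upper_variation M \<nu> ((\<Union>i<n. A i) \<union> A n)"
    proof (rule upper_variation_superadd[OF sm])
      have "A i \<inter> A n = {}" if "i < n" for i
        using A(2) that by (intro disjoint_family_onD[OF A(2)]) auto
      then show "(\<Union>i<n. A i) \<inter> A n = {}" by blast
    qed
    also have "(\<Union>i<n. A i) \<union> A n = (\<Union>i<Suc n. A i)"
      by (auto simp: lessThan_Suc)
    finally show ?case .
  qed
  show "(\<Sum>i. upper_variation M \<nu> (A i)) \<le> upper_variation M \<nu> (\<Union> (range A))"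
    unfolding suminf_eq_SUP
    by (intro SUP_least order_trans[OF fin] upper_variation_mono) auto
  show "upper_variation M \<nu> (\<Union> (range A)) \<le> (\<Sum>i. upper_variation M \<nu> (A i))"
    unfolding upper_variation_def[of M \<nu> "\<Union> (range A)"]
  proof (intro SUP_least)
    fix B assume "B \<in> {B \<in> sets M. B \<subseteq> \<Union> (range A)}"
    then have B: "B \<in> sets M" "B \<subseteq> (\<Union>i. A i)" by auto
    have "(\<lambda>i. \<nu> (B \<inter> A i)) sums \<nu> (\<Union>i. B \<inter> A i)"
    proof -
      have "range (\<lambda>i. B \<inter> A i) \<subseteq> sets M" using A(1) B(1) by blast
      moreover have "disjoint_family (\<lambda>i. B \<inter> A i)"
        using A(2) unfolding disjoint_family_on_def by blast
      ultimately show ?thesis using sm unfolding signed_measure_def by blast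
    qed
    moreover have "(\<Union>i. B \<inter> A i) = B" using B by auto
    ultimately have s: "(\<lambda>n. \<Sum>i<n. \<nu> (B \<inter> A i)) \<longlonglongrightarrow> \<nu> B"
      by (simp add: sums_def)
    have "ennreal (\<Sum>i<n. \<nu> (B \<inter> A i)) \<le> (\<Sum>i. upper_variation M \<nu> (A i))" for n
    proof -
      have "ennreal (\<Sum>i<n. \<nu> (B \<inter> A i)) \<le> ennreal (\<Sum>i<n. max 0 (\<nu> (B \<inter> A i)))"
        by (intro ennreal_leI sum_mono) auto
      also have "\<dots> = (\<Sum>i<n. ennreal (max 0 (\<nu> (B \<inter> A i))))"
        by (intro sum_ennreal[symmetric]) auto
      also have "\<dots> = (\<Sum>i<n. ennreal (\<nu> (B \<inter> A i)))"
        by (intro sum.cong) (auto simp: max_def ennreal_neg)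
      also have "\<dots> \<le> (\<Sum>i<n. upper_variation M \<nu> (A i))"
        using A B by (intro sum_mono upper_variation_upper) auto
      also have "\<dots> \<le> (\<Sum>i. upper_variation M \<nu> (A i))"
        by (intro sum_le_suminf) auto
      finally show ?thesis .
    qed
    then show "ennreal (\<nu> B) \<le> (\<Sum>i. upper_variation M \<nu> (A i))"
      by (intro LIMSEQ_le_const2[OF tendsto_ennrealI[OF s]]) auto
  qed
qed

lemma emeasure_pos_part_measure:
  assumes "signed_measure M \<nu>" "A \<in> sets M"
  shows "emeasure (pos_part_measure M \<nu>) A = upper_variation M \<nu> A"
  using countably_additive_upper_variation[OF assms(1)] upper_variation_empty[OF assms(1)] assms(2)
  by (intro emeasure_measure_of[OF pos_part_measure_def])
     (auto simp: pos_part_measure_def positive_def sets.space_closed)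

lemma emeasure_neg_part_measure:
  assumes "signed_measure M \<nu>" "A \<in> sets M"
  shows "emeasure (neg_part_measure M \<nu>) A = lower_variation M \<nu> A"
  using emeasure_pos_part_measure[OF signed_measure_uminus[OF assms(1)] assms(2)]
  by (simp add: neg_part_measure_def pos_part_measure_def lower_variation_def)

end

theory Submission
  imports Defs "HOL-Real_Asymp.Real_Asymp"
begin

text \<open>
  Both classes consist of the functions that agree almost everywhere on \<open>{a<..<b}\<close>, up to an additive
  constant, with the distribution function \<open>F s = \<nu> {a<..s}\<close> of a finite signed measure \<open>\<nu>\<close>. The bridge
  between the two conditions is the formula \<open>\<integral> \<phi> d\<nu> = - \<integral> \<phi>' F\<close> for test functions \<open>\<phi>\<close>
  (\<open>signed_integral_test_function\<close>), which is Fubini's theorem applied to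
  \<open>\<phi> t = - \<integral> \<phi>'\<close> over \<open>{t..<b}\<close>: it says that the weak derivative of \<open>F\<close> is \<open>\<nu>\<close>.

  If the weak derivative of \<open>f\<close> is \<open>\<nu>\<close>, then \<open>f - F\<close> is orthogonal to all derivatives of test
  functions, hence almost everywhere constant (\<open>du_Bois_Reymond\<close>). On the set where \<open>f\<close> equals \<open>F\<close> plus
  this constant, the variation of \<open>f\<close> is at most the mass of the total variation of \<open>\<nu>\<close>
  (\<open>variation_on_distribution_function\<close>).

  Conversely, let \<open>f\<close> have finite variation on the complement \<open>S\<close> of a null set, and let \<open>v\<close> be its
  variation up to a point. Then \<open>v\<close> and \<open>v - f\<close> are increasing on \<open>S\<close> and bounded
  (\<open>variation_on_increment\<close>). A bounded increasing function on \<open>S\<close> is, up to a constant and a null set,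
  the distribution function of a finite measure (\<open>monotone_eq_distribution_function\<close>), because
  monotone functions have only countably many discontinuities. The difference of the two measures is
  the derivative of \<open>f\<close>.

  The lemma of du Bois-Reymond needs enough test functions. Bumps built from \<open>exp (- 1 / x)\<close> approximate
  indicators of intervals, and combinations of two bumps of integral zero are derivatives of test
  functions; in the limit the mean value of the function over a subinterval does not depend on the
  subinterval.
\<close>

section \<open>Smooth functions and bump functions\<close>

definition smooth :: "(real \<Rightarrow> real) \<Rightarrow> bool" where
  "smooth f \<longleftrightarrow> (\<forall>n x. ((deriv ^^ n) f) differentiable (at x))"

text \<open>
  Showing that all iterated derivatives exist by induction on their order needs a formula for the
  \<open>n\<close>-th one. It is enough to find a class of functions that is closed under differentiation, and
  such a class is usually visible at once.
\<close>

lemma smooth_coinduct: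
  assumes "P f"
    and step: "\<And>u. P u \<Longrightarrow> \<exists>u'. P u' \<and> (\<forall>x. (u has_real_derivative u' x) (at x))"
  shows "smooth f"
proof -
  have "P ((deriv ^^ n) f)" for n
  proof (induction n)
    case (Suc n)
    then obtain u' where u': "P u'" "\<And>x. ((deriv ^^ n) f has_real_derivative u' x) (at x)"
      using step by blast
    have "(deriv ^^ Suc n) f = u'"
      using u'(2) by (auto intro!: DERIV_imp_deriv)
    with u'(1) show ?case by simp
  qed (simp add: assms(1))
  then show ?thesis
    unfolding smooth_def using step real_differentiable_def by blast
qed

lemma smooth_derivI:
  assumes "smooth f"
  shows "smooth (deriv f)" and "(f has_real_derivative deriv f x) (at x)"
proof -
  have *: "((deriv ^^ n) f) differentiable (at x)" for n x
    using assms unfolding smooth_def by blast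
  show "smooth (deriv f)"
    unfolding smooth_def using *[of "Suc _"] by (simp add: funpow_Suc_right del: funpow.simps)
  show "(f has_real_derivative deriv f x) (at x)"
    using *[of 0] by (simp add: DERIV_deriv_iff_real_differentiable)
qed

lemma smooth_primitive:
  assumes "smooth g" "\<And>x. (f has_real_derivative g x) (at x)"
  shows "smooth f"
  by (rule smooth_coinduct[where P = "\<lambda>u. u = f \<or> smooth u"]) (use assms smooth_derivI in blast)+

lemma smooth_lincomb:
  assumes "smooth f" "smooth g"
  shows "smooth (\<lambda>x. c * f x - e * g x)"
proof (rule smooth_coinduct[where P = "\<lambda>u. \<exists>f g. smooth f \<and> smooth g \<and> u = (\<lambda>x. c * f x - e * g x)"])
  fix u assume "\<exists>f g. smooth f \<and> smooth g \<and> u = (\<lambda>x. c * f x - e * g x)"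
  then obtain f g where fg: "smooth f" "smooth g" "u = (\<lambda>x. c * f x - e * g x)" by blast
  show "\<exists>u'. (\<exists>f g. smooth f \<and> smooth g \<and> u' = (\<lambda>x. c * f x - e * g x)) \<and>
      (\<forall>x. (u has_real_derivative u' x) (at x))"
    using fg smooth_derivI[OF fg(1)] smooth_derivI[OF fg(2)]
    by (intro exI[of _ "\<lambda>x. c * deriv f x - e * deriv g x"])
       (auto intro!: derivative_eq_intros)
qed (use assms in blast)

lemma continuous_on_smooth: "smooth f \<Longrightarrow> continuous_on S f"
  using smooth_derivI(2) by (meson DERIV_isCont continuous_at_imp_continuous_on)

text \<open>
  For \<open>p = 1\<close> this is the standard smooth function that vanishes exactly on \<open>{..0}\<close>. The polynomial
  factor in \<open>1 / x\<close> makes the family closed under differentiation.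
\<close>

definition flat :: "real poly \<Rightarrow> real \<Rightarrow> real" where
  "flat p x = (if x > 0 then poly p (1 / x) * exp (- (1 / x)) else 0)"

lemma tendsto_poly_div_exp_0: "((\<lambda>x::real. x ^ k * poly p x / exp x) \<longlongrightarrow> 0) at_top"
proof (induction p arbitrary: k)
  case (pCons c p)
  have "((\<lambda>x::real. c * (x ^ k / exp x) + x ^ Suc k * poly p x / exp x) \<longlongrightarrow> c * 0 + 0) at_top"
    by (intro tendsto_intros tendsto_power_div_exp_0 pCons.IH)
  then show ?case by (simp add: algebra_simps add_divide_distrib)
qed simp

lemma tendsto_flat_0: "(flat p \<longlongrightarrow> 0) (at 0)"
proof -
  have "((\<lambda>x. poly p (inverse x) / exp (inverse x)) \<longlongrightarrow> 0) (at_right 0)"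
    using filterlim_compose[OF tendsto_poly_div_exp_0[of 0 p] filterlim_inverse_at_top_right]
    by simp
  then have "(flat p \<longlongrightarrow> 0) (at_right 0)"
    by (rule Lim_transform_eventually)
       (auto simp: eventually_at_filter flat_def exp_minus field_simps)
  moreover have "(flat p \<longlongrightarrow> 0) (at_left 0)"
    by (rule tendsto_eventually) (auto simp: eventually_at_filter flat_def)
  ultimately show ?thesis by (simp add: filterlim_split_at)
qed

text \<open>
  To the right of \<open>0\<close> this is the product rule in the variable \<open>t = 1 / x\<close>, where \<open>dt/dx = - t^2\<close>. At
  \<open>0\<close> the difference quotient of \<open>flat p\<close> is again flat, with \<open>p\<close> replaced by \<open>t * p\<close>, so it tends
  to \<open>0\<close>.
\<close>

lemma DERIV_flat:
  "(flat p has_real_derivative flat ([:0, 0, 1:] * (p - pderiv p)) x) (at x)"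
proof (cases x "0::real" rule: linorder_cases)
  case less
  have "(flat p has_real_derivative 0) (at x)"
    by (rule DERIV_cong_ev[THEN iffD1, OF refl _ refl DERIV_const[of 0]])
       (use less in \<open>auto simp: flat_def intro!: eventually_nhds_in_open[of "{..<0}", THEN eventually_mono]\<close>)
  then show ?thesis using less by (simp add: flat_def)
next
  case equal
  have "((\<lambda>h. flat p h / h) \<longlongrightarrow> 0) (at 0)"
    by (rule Lim_transform_eventually[OF tendsto_flat_0[of "pCons 0 p"]])
       (auto simp: flat_def eventually_at_filter)
  then show ?thesis
    unfolding equal DERIV_def by (simp add: flat_def)
next
  case greater
  have "((\<lambda>x. poly p (1 / x) * exp (- (1 / x))) has_real_derivative
      flat ([:0, 0, 1:] * (p - pderiv p)) x) (at x)"
    using greater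
    by (auto intro!: derivative_eq_intros simp: flat_def field_simps power2_eq_square)
  then show ?thesis
    by (rule DERIV_cong_ev[THEN iffD1, OF refl _ refl, rotated])
       (use greater in \<open>auto simp: flat_def intro!: eventually_nhds_in_open[of "{0<..}", THEN eventually_mono]\<close>)
qed

text \<open>
  A class closed under differentiation that contains the bump functions below; the linear
  combinations are exactly those produced by the product rule.
\<close>

inductive flat_product :: "real \<Rightarrow> real \<Rightarrow> real \<Rightarrow> (real \<Rightarrow> real) \<Rightarrow> bool" for k c d where
  base: "flat_product k c d (\<lambda>x. flat p (k * (x - c)) * flat q (k * (d - x)))"
| lincomb: "flat_product k c d u \<Longrightarrow> flat_product k c d v \<Longrightarrow> flat_product k c d (\<lambda>x. k * u x - k * v x)"

definition bump :: "real \<Rightarrow> real \<Rightarrow> real \<Rightarrow> real \<Rightarrow> real" where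
  "bump k c d x = flat 1 (k * (x - c)) * flat 1 (k * (d - x))"

lemma smooth_bump: "smooth (bump k c d)"
proof (rule smooth_coinduct)
  show "flat_product k c d (bump k c d)"
    unfolding bump_def[abs_def] by (rule base)
next
  fix u assume "flat_product k c d u"
  then show "\<exists>u'. flat_product k c d u' \<and> (\<forall>x. (u has_real_derivative u' x) (at x))"
  proof induction
    case (base p q)
    let ?D = "\<lambda>p. [:0, 0, 1:] * (p - pderiv p)"
    let ?u = "\<lambda>p x. flat p (k * (x - c))" and ?v = "\<lambda>p x. flat p (k * (d - x))"
    have 1: "(?u p has_real_derivative k * ?u (?D p) x) (at x)" for x
      by (rule DERIV_cong[OF DERIV_chain2[OF DERIV_flat]])
         (auto intro!: derivative_eq_intros)
    have 2: "(?v q has_real_derivative - k * ?v (?D q) x) (at x)" for x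
      by (rule DERIV_cong[OF DERIV_chain2[OF DERIV_flat]])
         (auto intro!: derivative_eq_intros)
    have D: "((\<lambda>x. ?u p x * ?v q x) has_real_derivative
        k * (?u (?D p) x * ?v q x) - k * (?u p x * ?v (?D q) x)) (at x)" for x
      by (rule DERIV_cong[OF DERIV_mult[OF 1 2]]) (simp only: algebra_simps)
    have "flat_product k c d (\<lambda>x. k * (?u (?D p) x * ?v q x) - k * (?u p x * ?v (?D q) x))"
      by (intro flat_product.intros)
    with D show ?case by blast
  next
    case (lincomb u v)
    then obtain u' v' where "flat_product k c d u'" "flat_product k c d v'"
      "\<And>x. (u has_real_derivative u' x) (at x)" "\<And>x. (v has_real_derivative v' x) (at x)"
      by blast
    then show ?case
      by (intro exI[of _ "\<lambda>x. k * u' x - k * v' x"])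
         (auto intro!: derivative_eq_intros flat_product.lincomb)
  qed
qed

lemma bump_bounds: "0 \<le> bump k c d x" "bump k c d x \<le> 1"
  by (auto simp: bump_def flat_def intro!: mult_le_one)

lemma bump_eq_0: "k > 0 \<Longrightarrow> \<not> (c < x \<and> x < d) \<Longrightarrow> bump k c d x = 0"
  by (auto simp: bump_def flat_def zero_less_mult_iff)

text \<open>
  Steepening the flanks makes the bumps converge to the indicator of the interval. Their supports are
  shrunk by \<open>1 / Suc n\<close> at each end, so that they stay compactly inside \<open>{a<..<b}\<close> even when
  \<open>c = a\<close> and \<open>d = b\<close>.
\<close>

lemma bump_tendsto_indicator:
  "(\<lambda>n. bump (real (Suc n)) (c + 1 / real (Suc n)) (d - 1 / real (Suc n)) x)
     \<longlonglongrightarrow> indicator {c<..<d} x"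
proof (cases "c < x \<and> x < d")
  case True
  have lim: "(\<lambda>n. flat 1 (real (Suc n) * t - 1)) \<longlonglongrightarrow> 1" if "t > 0" for t
  proof -
    have *: "filterlim (\<lambda>n. real (Suc n) * t - 1) at_top sequentially"
      using that by real_asymp
    have lim: "(\<lambda>n. exp (- (inverse (real (Suc n) * t - 1)))) \<longlonglongrightarrow> exp (- 0)"
      by (intro tendsto_intros tendsto_inverse_0_at_top *)
    have "\<forall>\<^sub>F n in sequentially. 0 < real (Suc n) * t - 1"
      using * unfolding filterlim_at_top_dense by (rule spec)
    then have "\<forall>\<^sub>F n in sequentially.
        exp (- (inverse (real (Suc n) * t - 1))) = flat 1 (real (Suc n) * t - 1)"
      by eventually_elim (simp add: flat_def divide_inverse)
    from Lim_transform_eventually[OF lim this] show ?thesis by simp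
  qed
  have "(\<lambda>n. flat 1 (real (Suc n) * (x - c) - 1) * flat 1 (real (Suc n) * (d - x) - 1))
      \<longlonglongrightarrow> 1 * 1"
    using True by (intro tendsto_intros lim) auto
  moreover have "bump (real (Suc n)) (c + 1 / real (Suc n)) (d - 1 / real (Suc n)) x
      = flat 1 (real (Suc n) * (x - c) - 1) * flat 1 (real (Suc n) * (d - x) - 1)" for n
    unfolding bump_def by (simp only: right_diff_distrib distrib_left nonzero_mult_div_cancel_left
        of_nat_neq_0 times_divide_eq_right mult_1_right) (simp add: algebra_simps)
  ultimately show ?thesis
    using True by simp
next
  case False
  have "bump (real (Suc n)) (c + 1 / real (Suc n)) (d - 1 / real (Suc n)) x = 0" for n
  proof (rule bump_eq_0)
    have "1 / real (Suc n) > 0" by simp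
    with False show "\<not> (c + 1 / real (Suc n) < x \<and> x < d - 1 / real (Suc n))" by linarith
  qed simp
  with False show ?thesis by (auto simp: indicator_def)
qed

section \<open>The lemma of du Bois-Reymond\<close>

lemma emeasure_lborel_Ioo_finite: "emeasure lborel {c<..<d :: real} < \<infinity>"
  by (cases "c \<le> d") auto

lemma integrable_bump: "k > 0 \<Longrightarrow> integrable lborel (bump k c d)"
  using borel_measurable_continuous_onI[OF continuous_on_smooth[OF smooth_bump]]
  by (intro integrableI_bounded_set[where A = "{c<..<d}" and B = 1])
     (auto simp: bump_bounds bump_eq_0 abs_of_nonneg emeasure_lborel_Ioo_finite[simplified])

lemma integral_deriv_smooth:
  assumes "smooth F" "x \<le> y"
  shows "(\<integral>t. indicator {x..y} t * deriv F t \<partial>lborel) = F y - F x"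
  using integral_FTC_atLeastAtMost[OF assms(2), of F "deriv F"]
    continuous_on_smooth[OF smooth_derivI(1)[OF assms(1)]] smooth_derivI(2)[OF assms(1)]
  by (simp add: has_real_derivative_iff_has_vector_derivative has_vector_derivative_at_within)

text \<open>
  A primitive of \<open>\<eta>\<close> is constant on either side of the support of \<open>\<eta>\<close>, and the mean value zero says
  that the two constants agree, so that both can be made \<open>0\<close>.
\<close>

lemma test_function_of_mean_zero:
  assumes \<eta>: "smooth \<eta>" and int: "integrable lborel \<eta>" "(\<integral>x. \<eta> x \<partial>lborel) = 0"
    and cd: "a < c" "c \<le> d" "d < b" and outside: "\<And>x. \<not> (c < x \<and> x < d) \<Longrightarrow> \<eta> x = 0"
  obtains \<phi> where "test_function a b \<phi>" "deriv \<phi> = \<eta>"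
proof -
  have cont: "continuous_on S \<eta>" for S
    using \<eta> by (rule continuous_on_smooth)
  have "\<exists>F. \<forall>x. -\<infinity> < ereal x \<longrightarrow> ereal x < \<infinity> \<longrightarrow> (F has_vector_derivative \<eta> x) (at x)"
    by (rule einterval_antiderivative)
       (use cont[of UNIV] in \<open>auto simp: continuous_on_eq_continuous_at\<close>)
  then obtain F where F: "\<And>x. (F has_real_derivative \<eta> x) (at x)"
    by (auto simp: has_real_derivative_iff_has_vector_derivative)
  define \<phi> where "\<phi> = (\<lambda>x. F x - F c)"
  have D: "(\<phi> has_real_derivative \<eta> x) (at x)" for x
    unfolding \<phi>_def by (auto intro!: derivative_eq_intros F)
  have "smooth \<phi>" using \<eta> D by (rule smooth_primitive)
  have deriv: "deriv \<phi> = \<eta>" using D by (auto intro: DERIV_imp_deriv)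
  have FTC: "\<phi> y - \<phi> x = (\<integral>t. indicator {x..y} t * \<eta> t \<partial>lborel)" if "x \<le> y" for x y
    using integral_deriv_smooth[OF \<open>smooth \<phi>\<close> that] by (simp add: deriv)
  have zero: "\<phi> x = 0" if "x \<notin> {c..d}" for x
  proof (cases "x < c")
    case True
    then have "(\<lambda>t. indicator {x..c} t * \<eta> t) = (\<lambda>t. 0)"
      using outside by (force simp: indicator_def)
    then show ?thesis using FTC[of x c] True by (simp add: \<phi>_def)
  next
    case False
    then have x: "d < x" using that by auto
    have "indicator {c..x} t * \<eta> t = \<eta> t" for t
      using outside[of t] x by (cases "c < t \<and> t < d") auto
    then have "(\<lambda>t. indicator {c..x} t * \<eta> t) = \<eta>" by blast
    then show ?thesis using FTC[of c x] int x cd by (simp add: \<phi>_def)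
  qed
  have "{x. \<phi> x \<noteq> 0} \<subseteq> {c..d}" using zero by blast
  then have sub: "closure {x. \<phi> x \<noteq> 0} \<subseteq> {c..d}"
    by (intro closure_minimal) auto
  have "compact (closure {x. \<phi> x \<noteq> 0})"
    using sub by (meson bounded_closed_interval bounded_subset closed_closure compact_eq_bounded_closed)
  moreover have "closure {x. \<phi> x \<noteq> 0} \<subseteq> {a<..<b}" using sub cd by auto
  ultimately have "test_function a b \<phi>"
    using \<open>smooth \<phi>\<close> unfolding test_function_def smooth_def by auto
  then show ?thesis using deriv by (rule that)
qed

lemma integrable_mult_bump:
  assumes "integrable lborel g"
  shows "integrable lborel (\<lambda>x. g x * bump k c d x)"
proof (rule Bochner_Integration.integrable_bound[OF assms])
  show "(\<lambda>x. g x * bump k c d x) \<in> borel_measurable lborel"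
    using assms borel_measurable_continuous_onI[OF continuous_on_smooth[OF smooth_bump]] by auto
  show "AE x in lborel. norm (g x * bump k c d x) \<le> norm (g x)"
    using bump_bounds by (auto simp: abs_mult intro!: mult_left_le)
qed

text \<open>
  Two bumps, each multiplied by the integral of the other, differ by a function of mean zero, which is
  the derivative of a test function and hence orthogonal to \<open>g\<close>.
\<close>

lemma integral_mult_bump_proportional:
  assumes ab: "a < b" and g: "integrable lborel g"
    and orth: "\<And>\<phi>. test_function a b \<phi> \<Longrightarrow> (\<integral>x. g x * deriv \<phi> x \<partial>lborel) = 0"
    and k: "k > 0" "k' > 0" and cd: "a < c" "d < b" "a < c'" "d' < b"
  shows "(\<integral>x. bump k' c' d' x \<partial>lborel) * (\<integral>x. g x * bump k c d x \<partial>lborel)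
    = (\<integral>x. bump k c d x \<partial>lborel) * (\<integral>x. g x * bump k' c' d' x \<partial>lborel)"
proof -
  let ?B = "bump k c d" and ?B' = "bump k' c' d'"
  let ?I = "\<integral>x. ?B x \<partial>lborel" and ?I' = "\<integral>x. ?B' x \<partial>lborel"
  define \<eta> where "\<eta> = (\<lambda>x. ?I' * ?B x - ?I * ?B' x)"
  have "smooth \<eta>" unfolding \<eta>_def by (intro smooth_lincomb smooth_bump)
  moreover have "integrable lborel \<eta>" "(\<integral>x. \<eta> x \<partial>lborel) = 0"
    unfolding \<eta>_def using integrable_bump[OF k(1)] integrable_bump[OF k(2)] by auto
  \<comment> \<open>The midpoint of the interval keeps the bounds ordered when the intervals of the bumps are empty.\<close>
  moreover have "\<eta> x = 0"
    if "\<not> (min (min c c') ((a + b) / 2) < x \<and> x < max (max d d') ((a + b) / 2))" for x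
    using that unfolding \<eta>_def by (subst (1 2) bump_eq_0) (auto simp: k)
  moreover have "a < min (min c c') ((a + b) / 2)"
    "min (min c c') ((a + b) / 2) \<le> max (max d d') ((a + b) / 2)"
    "max (max d d') ((a + b) / 2) < b" using cd ab by auto
  ultimately obtain \<phi> where "test_function a b \<phi>" "deriv \<phi> = \<eta>"
    using test_function_of_mean_zero by metis
  then have "0 = (\<integral>x. g x * \<eta> x \<partial>lborel)" using orth by metis
  also have "\<dots> = (\<integral>x. ?I' * (g x * ?B x) - ?I * (g x * ?B' x) \<partial>lborel)"
    by (simp add: \<eta>_def algebra_simps)
  also have "\<dots> = ?I' * (\<integral>x. g x * ?B x \<partial>lborel) - ?I * (\<integral>x. g x * ?B' x \<partial>lborel)"
    using integrable_mult_bump[OF g] by simp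
  finally show ?thesis by simp
qed

lemma integral_mult_bump_tendsto:
  assumes g: "integrable lborel g"
  shows "(\<lambda>n. \<integral>x. g x * bump (real (Suc n)) (c + 1 / real (Suc n)) (d - 1 / real (Suc n)) x \<partial>lborel)
    \<longlonglongrightarrow> (\<integral>x. g x * indicator {c<..<d} x \<partial>lborel)"
proof (rule integral_dominated_convergence[where w = "\<lambda>x. norm (g x)"])
  show "AE x in lborel. (\<lambda>n. g x * bump (real (Suc n)) (c + 1 / real (Suc n)) (d - 1 / real (Suc n)) x)
      \<longlonglongrightarrow> g x * indicator {c<..<d} x"
    by (intro AE_I2 tendsto_intros bump_tendsto_indicator)
  show "AE x in lborel. norm (g x * bump (real (Suc n)) (c + 1 / real (Suc n)) (d - 1 / real (Suc n)) x)
      \<le> norm (g x)" for n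
    using bump_bounds by (auto simp: abs_mult intro!: mult_left_le)
qed (use g integrable_mult_bump[OF g] in auto)

text \<open>
  The limit of the previous identity as the bumps become indicators: up to the factor given by the
  length of the interval, the integral of \<open>g\<close> over a subinterval does not depend on it.
\<close>

lemma integral_Ioo_proportional:
  fixes a b c d :: real
  assumes ab: "a < b" and g: "integrable lborel g"
    and orth: "\<And>\<phi>. test_function a b \<phi> \<Longrightarrow> (\<integral>x. g x * deriv \<phi> x \<partial>lborel) = 0"
    and cd: "a \<le> c" "c \<le> d" "d \<le> b"
  shows "(b - a) * (\<integral>x. g x * indicator {c<..<d} x \<partial>lborel)
    = (d - c) * (\<integral>x. g x * indicator {a<..<b} x \<partial>lborel)"
proof -
  let ?h = "\<lambda>c d n. bump (real (Suc n)) (c + 1 / real (Suc n)) (d - 1 / real (Suc n))"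
  have len: "(\<lambda>n. \<integral>x. ?h c d n x \<partial>lborel) \<longlonglongrightarrow> d - c"
    if "a \<le> c" "c \<le> d" "d \<le> b" for c d
  proof -
    have "integrable lborel (indicator {a<..<b} :: real \<Rightarrow> real)" using ab by auto
    from integral_mult_bump_tendsto[OF this, of c d]
    have "(\<lambda>n. \<integral>x. indicator {a<..<b} x * ?h c d n x \<partial>lborel)
        \<longlonglongrightarrow> (\<integral>x. indicator {a<..<b} x * indicator {c<..<d} x \<partial>lborel)" .
    moreover have "(\<lambda>x. indicator {a<..<b} x * ?h c d n x) = ?h c d n" for n
    proof
      fix x
      have pos: "1 / real (Suc n) > 0" by simp
      show "indicator {a<..<b} x * ?h c d n x = ?h c d n x"
      proof (cases "x \<in> {a<..<b}")
        case False
        then have "\<not> (c + 1 / real (Suc n) < x \<and> x < d - 1 / real (Suc n))"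
          using pos that unfolding greaterThanLessThan_iff by linarith
        then have "?h c d n x = 0" by (intro bump_eq_0) auto
        then show ?thesis by simp
      qed simp
    qed
    moreover have "(\<lambda>x. indicator {a<..<b} x * indicator {c<..<d} x :: real) = indicator {c<..<d}"
      using that by (auto simp: indicator_def fun_eq_iff)
    ultimately show ?thesis using that by simp
  qed
  have "(\<lambda>n. (\<integral>x. ?h a b n x \<partial>lborel) * (\<integral>x. g x * ?h c d n x \<partial>lborel))
      \<longlonglongrightarrow> (b - a) * (\<integral>x. g x * indicator {c<..<d} x \<partial>lborel)"
    using ab by (intro tendsto_intros len integral_mult_bump_tendsto g) auto
  moreover have "(\<lambda>n. (\<integral>x. ?h c d n x \<partial>lborel) * (\<integral>x. g x * ?h a b n x \<partial>lborel))
      \<longlonglongrightarrow> (d - c) * (\<integral>x. g x * indicator {a<..<b} x \<partial>lborel)"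
    using cd by (intro tendsto_intros len integral_mult_bump_tendsto g) auto
  moreover have "(\<integral>x. ?h a b n x \<partial>lborel) * (\<integral>x. g x * ?h c d n x \<partial>lborel)
      = (\<integral>x. ?h c d n x \<partial>lborel) * (\<integral>x. g x * ?h a b n x \<partial>lborel)" for n
  proof (rule integral_mult_bump_proportional[OF ab g orth])
    have pos: "1 / real (Suc n) > 0" by simp
    show "a < a + 1 / real (Suc n)" "a < c + 1 / real (Suc n)"
      "b - 1 / real (Suc n) < b" "d - 1 / real (Suc n) < b"
      using pos cd by linarith+
  qed auto
  ultimately show ?thesis
    by (simp add: LIMSEQ_unique)
qed

text \<open>
  The positive and the negative part of \<open>f\<close> are densities of two finite measures that agree on the
  half-lines, hence everywhere.
\<close>

lemma AE_eq_0_of_integral_Ioi: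
  fixes f :: "real \<Rightarrow> real"
  assumes f: "integrable lborel f"
    and zero: "\<And>x. (\<integral>y. f y * indicator {x<..} y \<partial>lborel) = 0"
  shows "AE x in lborel. f x = 0"
proof -
  have em: "emeasure (density lborel (\<lambda>y. ennreal (h y))) {x<..}
      = ennreal (\<integral>y. max 0 (h y) * indicator {x<..} y \<partial>lborel)"
    if h: "integrable lborel h" for h :: "real \<Rightarrow> real" and x
  proof -
    have "integrable lborel (\<lambda>y. max 0 (h y) * indicator {x<..} y)"
      using h by (intro integrable_real_mult_indicator) auto
    then have "ennreal (\<integral>y. max 0 (h y) * indicator {x<..} y \<partial>lborel)
        = (\<integral>\<^sup>+y. ennreal (max 0 (h y) * indicator {x<..} y) \<partial>lborel)"
      by (intro nn_integral_eq_integral[symmetric]) auto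
    also have "\<dots> = (\<integral>\<^sup>+y. ennreal (h y) * indicator {x<..} y \<partial>lborel)"
      by (intro nn_integral_cong) (auto simp: indicator_def max_def ennreal_neg)
    finally show ?thesis using h by (simp add: emeasure_density)
  qed
  have "density lborel (\<lambda>y. ennreal (f y)) = density lborel (\<lambda>y. ennreal (- f y))"
  proof (rule measure_eqI_lessThan)
    fix x
    have int: "integrable lborel (\<lambda>y. max 0 (f y) * indicator {x<..} y)"
      "integrable lborel (\<lambda>y. max 0 (- f y) * indicator {x<..} y)"
      using f by (intro integrable_real_mult_indicator; auto)+
    have "(\<integral>y. max 0 (f y) * indicator {x<..} y \<partial>lborel)
        - (\<integral>y. max 0 (- f y) * indicator {x<..} y \<partial>lborel)
        = (\<integral>y. max 0 (f y) * indicator {x<..} y - max 0 (- f y) * indicator {x<..} y \<partial>lborel)"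
      using int by simp
    also have "\<dots> = (\<integral>y. f y * indicator {x<..} y \<partial>lborel)"
      by (intro Bochner_Integration.integral_cong) (auto simp: max_def algebra_simps)
    also have "\<dots> = 0" by (rule zero)
    finally show "emeasure (density lborel (\<lambda>y. ennreal (f y))) {x<..}
        = emeasure (density lborel (\<lambda>y. ennreal (- f y))) {x<..}"
      using f by (simp add: em)
    show "emeasure (density lborel (\<lambda>y. ennreal (f y))) {x<..} < \<infinity>"
      using f by (simp add: em)
  qed auto
  then have "AE x in lborel. ennreal (f x) = ennreal (- f x)"
    using f by (intro sigma_finite_measure.density_unique[OF sigma_finite_lborel]) auto
  then show ?thesis
    by eventually_elim (metis ennreal_eq_0_iff ennreal_inj linorder_linear neg_equal_iff_equal
        neg_le_0_iff_le order_antisym)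
qed

theorem du_Bois_Reymond:
  fixes g :: "real \<Rightarrow> real"
  assumes ab: "a < b" and g: "integrable lborel g"
    and orth: "\<And>\<phi>. test_function a b \<phi> \<Longrightarrow> (\<integral>x. g x * deriv \<phi> x \<partial>lborel) = 0"
  obtains K where "AE x in lborel. x \<in> {a<..<b} \<longrightarrow> g x = K"
proof -
  define K where "K = (\<integral>x. g x * indicator {a<..<b} x \<partial>lborel) / (b - a)"
  let ?f = "\<lambda>x. g x * indicator {a<..<b} x - K * indicator {a<..<b} x"
  have int: "integrable lborel (\<lambda>x. g x * indicator {c<..<d} x)"
    "integrable lborel (\<lambda>x. K * indicator {c<..<d} x)" for c d :: real
    using g by (auto intro!: integrable_real_mult_indicator simp: emeasure_lborel_Ioo_finite[simplified])
  have "AE x in lborel. ?f x = 0"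
  proof (rule AE_eq_0_of_integral_Ioi)
    show "integrable lborel ?f" using int by auto
    fix x
    define c where "c = min b (max a x)"
    have c: "a \<le> c" "c \<le> b" using ab by (auto simp: c_def)
    have "(\<integral>y. ?f y * indicator {x<..} y \<partial>lborel)
        = (\<integral>y. g y * indicator {c<..<b} y - K * indicator {c<..<b} y \<partial>lborel)"
      by (intro Bochner_Integration.integral_cong) (auto simp: indicator_def c_def)
    also have "\<dots> = (\<integral>y. g y * indicator {c<..<b} y \<partial>lborel) - K * (b - c)"
      using int c by simp
    also have "\<dots> = 0"
      using integral_Ioo_proportional[OF ab g orth, of c b] c ab by (simp add: K_def field_simps)
    finally show "(\<integral>y. ?f y * indicator {x<..} y \<partial>lborel) = 0" .
  qed
  then have "AE x in lborel. x \<in> {a<..<b} \<longrightarrow> g x = K" by eventually_elim auto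
  then show ?thesis by (rule that)
qed

section \<open>Test functions and distribution functions\<close>

lemma test_functionD:
  assumes "test_function a b \<phi>"
  shows "smooth \<phi>" and "x \<notin> {a<..<b} \<Longrightarrow> \<phi> x = 0"
  using assms closure_subset[of "{x. \<phi> x \<noteq> 0}"] unfolding test_function_def smooth_def by auto

lemma bounded_deriv_test_function:
  assumes "test_function a b \<phi>"
  obtains B where "\<And>x. \<bar>deriv \<phi> x\<bar> \<le> B"
proof -
  have "bounded (deriv \<phi> ` {a..b})"
    using test_functionD(1)[OF assms]
    by (intro compact_imp_bounded compact_continuous_image continuous_on_smooth smooth_derivI) auto
  then obtain B where B: "\<forall>x\<in>{a..b}. \<bar>deriv \<phi> x\<bar> \<le> B" by (auto simp: bounded_iff)
  have zero: "deriv \<phi> x = 0" if "x \<notin> {a..b}" for x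
  proof -
    have "\<forall>\<^sub>F y in nhds x. \<phi> y = 0"
      using that test_functionD(2)[OF assms]
      by (intro eventually_nhds_in_open[of "- {a..b}", THEN eventually_mono]) auto
    from deriv_cong_ev[OF this refl] show ?thesis by simp
  qed
  have "\<bar>deriv \<phi> x\<bar> \<le> max B 0" for x
  proof (cases "x \<in> {a..b}")
    case True
    with B show ?thesis by fastforce
  qed (simp add: zero)
  then show ?thesis by (rule that)
qed

lemma borel_measurable_deriv_test_function:
  "test_function a b \<phi> \<Longrightarrow> deriv \<phi> \<in> borel_measurable borel"
  by (intro borel_measurable_continuous_onI continuous_on_smooth smooth_derivI test_functionD(1))

lemma integrable_mult_deriv_test_function:
  assumes "test_function a b \<phi>" "integrable lborel g"
  shows "integrable lborel (\<lambda>x. g x * deriv \<phi> x)"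
proof -
  obtain B where B: "\<And>x. \<bar>deriv \<phi> x\<bar> \<le> B"
    using bounded_deriv_test_function[OF assms(1)] by blast
  show ?thesis
  proof (rule Bochner_Integration.integrable_bound)
    show "integrable lborel (\<lambda>x. B * g x)" using assms(2) by simp
    show "(\<lambda>x. g x * deriv \<phi> x) \<in> borel_measurable lborel"
      using assms borel_measurable_deriv_test_function by auto
    have "\<bar>g x * deriv \<phi> x\<bar> \<le> \<bar>B * g x\<bar>" for x
    proof -
      have "\<bar>g x\<bar> * \<bar>deriv \<phi> x\<bar> \<le> \<bar>g x\<bar> * \<bar>B\<bar>"
        using B[of x] by (intro mult_left_mono) auto
      then show ?thesis by (simp add: abs_mult mult.commute)
    qed
    then show "AE x in lborel. norm (g x * deriv \<phi> x) \<le> norm (B * g x)" by simp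
  qed
qed

lemma integral_deriv_test_function:
  assumes "test_function a b \<phi>" "x < b"
  shows "(\<integral>t. indicator {x..<b} t * deriv \<phi> t \<partial>lborel) = - \<phi> x"
proof -
  note [measurable] = borel_measurable_deriv_test_function[OF assms(1)]
  have "(\<integral>t. indicator {x..<b} t * deriv \<phi> t \<partial>lborel)
      = (\<integral>t. indicator {x..b} t * deriv \<phi> t \<partial>lborel)"
    using AE_lborel_singleton[of b]
    by (intro integral_cong_AE) (auto simp: indicator_def elim!: eventually_mono)
  then show ?thesis
    using integral_deriv_smooth[OF test_functionD(1)[OF assms(1)], of x b]
      test_functionD(2)[OF assms(1), of b] assms(2) by simp
qed

lemma space_borel_interval: "space (borel_interval a b) = {a<..<b}"
  by (simp add: space_restrict_space)

lemma sets_borel_interval: "A \<in> sets (borel_interval a b) \<longleftrightarrow> A \<in> sets borel \<and> A \<subseteq> {a<..<b}"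
  by (auto simp: sets_restrict_space_iff)

text \<open>
  Fubini for the region \<open>t \<le> s\<close> in the square of \<open>{a<..<b}\<close>: integrating \<open>h s\<close> over it in \<open>t\<close> first
  produces the distribution function \<open>\<mu> {a<..s}\<close>.
\<close>

lemma Fubini_distribution_function:
  fixes h :: "real \<Rightarrow> real"
  assumes "finite_measure \<mu>" and sets: "sets \<mu> = sets (borel_interval a b)"
    and h [measurable]: "h \<in> borel_measurable borel"
    and bound: "\<And>s. s \<in> {a<..<b} \<Longrightarrow> \<bar>h s\<bar> \<le> B"
  shows "integrable lborel (\<lambda>s. h s * (indicator {a<..<b} s * measure \<mu> {a<..s}))"
    and "(\<integral>t. (\<integral>s. indicator {t..<b} s * h s \<partial>lborel) \<partial>\<mu>)
      = (\<integral>s. h s * (indicator {a<..<b} s * measure \<mu> {a<..s}) \<partial>lborel)"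
proof -
  interpret \<mu>: finite_measure \<mu> by fact
  interpret P: pair_sigma_finite \<mu> lborel ..
  have space: "space \<mu> = {a<..<b}"
    using sets_eq_imp_space_eq[OF sets] by (simp add: space_borel_interval)
  have id: "(\<lambda>x. x) \<in> borel_measurable \<mu>"
    unfolding measurable_cong_sets[OF sets refl] by (intro measurable_restrict_space1) auto
  have [measurable]: "fst \<in> borel_measurable (\<mu> \<Otimes>\<^sub>M (lborel :: real measure))"
    by (rule measurable_compose[OF measurable_fst id])
  let ?k = "\<lambda>t s. indicator {t..<b} s * h s"
  have "(\<lambda>p. if fst p \<le> snd p \<and> snd p < b then h (snd p) else 0)
      \<in> borel_measurable (\<mu> \<Otimes>\<^sub>M lborel)"
    by measurable
  also have "(\<lambda>p. if fst p \<le> snd p \<and> snd p < b then h (snd p) else 0) = case_prod ?k"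
    by (auto simp: indicator_def)
  finally have meas: "case_prod ?k \<in> borel_measurable (\<mu> \<Otimes>\<^sub>M lborel)" .
  have "integrable (\<mu> \<Otimes>\<^sub>M lborel) (case_prod ?k)"
  proof (rule integrableI_bounded_set[where A = "{a<..<b} \<times> {a<..<b}" and B = B])
    show "{a<..<b} \<times> {a<..<b} \<in> sets (\<mu> \<Otimes>\<^sub>M lborel)"
      using sets.top[of \<mu>] by (intro pair_measureI) (auto simp: space)
    show "emeasure (\<mu> \<Otimes>\<^sub>M lborel) ({a<..<b} \<times> {a<..<b}) < \<infinity>"
      using sets.top[of \<mu>] emeasure_lborel_Ioo_finite[of a b]
        less_top[THEN iffD1, OF \<mu>.emeasure_finite[of "{a<..<b}"]]
      by (subst lborel.emeasure_pair_measure_Times)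
         (auto simp: space ennreal_mult_less_top less_top)
    show "AE p in \<mu> \<Otimes>\<^sub>M lborel. p \<in> {a<..<b} \<times> {a<..<b} \<longrightarrow> norm (case_prod ?k p) \<le> B"
      using bound order_trans[OF abs_ge_zero bound] by (intro AE_I2) (auto simp: indicator_def)
    show "AE p in \<mu> \<Otimes>\<^sub>M lborel. p \<notin> {a<..<b} \<times> {a<..<b} \<longrightarrow> case_prod ?k p = 0"
      by (intro AE_I2) (auto simp: indicator_def space_pair_measure space)
  qed (use meas in auto)
  note int = this
  have inner: "(\<integral>t. ?k t s \<partial>\<mu>) = h s * (indicator {a<..<b} s * measure \<mu> {a<..s})" for s
  proof (cases "s \<in> {a<..<b}")
    case True
    then have "{a<..s} \<in> sets \<mu>" by (auto simp: sets sets_borel_interval)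
    then have eq: "(\<integral>t. indicator {a<..s} t * h s \<partial>\<mu>) = measure \<mu> {a<..s} * h s"
      using \<mu>.emeasure_finite by (simp add: less_top)
    have "(\<integral>t. ?k t s \<partial>\<mu>) = (\<integral>t. indicator {a<..s} t * h s \<partial>\<mu>)"
      using True by (intro Bochner_Integration.integral_cong) (auto simp: indicator_def space)
    then show ?thesis unfolding eq using True by (simp only:) simp
  next
    case False
    then have "(\<integral>t. ?k t s \<partial>\<mu>) = (\<integral>t. 0 \<partial>\<mu>)"
      by (intro Bochner_Integration.integral_cong) (auto simp: indicator_def space)
    then show ?thesis using False by simp
  qed
  show "integrable lborel (\<lambda>s. h s * (indicator {a<..<b} s * measure \<mu> {a<..s}))"
    and "(\<integral>t. (\<integral>s. ?k t s \<partial>lborel) \<partial>\<mu>)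
      = (\<integral>s. h s * (indicator {a<..<b} s * measure \<mu> {a<..s}) \<partial>lborel)"
    using P.integrable_snd[OF int] P.Fubini_integral[OF int] unfolding inner by simp_all
qed

text \<open>
  Integration by parts against the distribution function, obtained from Fubini by writing \<open>\<phi> t\<close> as minus
  the integral of its derivative over \<open>{t..<b}\<close>.
\<close>

lemma integral_test_function:
  assumes \<mu>: "finite_measure \<mu>" and sets: "sets \<mu> = sets (borel_interval a b)"
    and \<phi>: "test_function a b \<phi>"
  shows "integrable lborel (\<lambda>s. deriv \<phi> s * (indicator {a<..<b} s * measure \<mu> {a<..s}))"
    and "(\<integral>t. \<phi> t \<partial>\<mu>) = - (\<integral>s. deriv \<phi> s * (indicator {a<..<b} s * measure \<mu> {a<..s}) \<partial>lborel)"
proof -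
  obtain B where B: "\<And>x. \<bar>deriv \<phi> x\<bar> \<le> B"
    using bounded_deriv_test_function[OF \<phi>] by blast
  note F = Fubini_distribution_function[OF \<mu> sets borel_measurable_deriv_test_function[OF \<phi>] B]
  have space: "space \<mu> = {a<..<b}"
    using sets_eq_imp_space_eq[OF sets] by (simp add: space_borel_interval)
  have "(\<integral>t. \<phi> t \<partial>\<mu>) = (\<integral>t. - (\<integral>s. indicator {t..<b} s * deriv \<phi> s \<partial>lborel) \<partial>\<mu>)"
    using integral_deriv_test_function[OF \<phi>]
    by (intro Bochner_Integration.integral_cong) (auto simp: space)
  with F(2) show "(\<integral>t. \<phi> t \<partial>\<mu>)
      = - (\<integral>s. deriv \<phi> s * (indicator {a<..<b} s * measure \<mu> {a<..s}) \<partial>lborel)"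
    by simp
  show "integrable lborel (\<lambda>s. deriv \<phi> s * (indicator {a<..<b} s * measure \<mu> {a<..s}))"
    by (rule F(1))
qed

text \<open>
  Passing from \<open>B\<close> to its complement \<open>A - B\<close> turns an upper bound for \<open>- \<nu>\<close> into one for \<open>\<nu>\<close>.
\<close>

lemma upper_variation_le:
  assumes sm: "signed_measure M \<nu>" and A: "A \<in> sets M" and fin: "lower_variation M \<nu> A < \<infinity>"
  shows "upper_variation M \<nu> A \<le> ennreal (\<nu> A + enn2real (lower_variation M \<nu> A))"
  unfolding upper_variation_def
proof (intro SUP_least ennreal_leI)
  fix B assume "B \<in> {B \<in> sets M. B \<subseteq> A}"
  then have B: "B \<in> sets M" "B \<subseteq> A" by auto
  then have "B \<union> (A - B) = A" by auto
  then have "\<nu> A = \<nu> B + \<nu> (A - B)"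
    using signed_measure_add[OF sm, of B "A - B"] A B by auto
  moreover have "ennreal (- \<nu> (A - B)) \<le> lower_variation M \<nu> A"
    unfolding lower_variation_def using A B by (intro upper_variation_upper) auto
  then have "- \<nu> (A - B) \<le> enn2real (lower_variation M \<nu> A)"
    using fin by (metis enn2real_mono enn2real_nonneg enn2real_ennreal infinity_ennreal_def
        linorder_linear order_trans)
  ultimately show "\<nu> B \<le> \<nu> A + enn2real (lower_variation M \<nu> A)" by linarith
qed

lemma Jordan_decomposition:
  assumes sm: "signed_measure M \<nu>" and A: "A \<in> sets M"
    and fin: "upper_variation M \<nu> A < \<infinity>" "lower_variation M \<nu> A < \<infinity>"
  shows "\<nu> A = enn2real (upper_variation M \<nu> A) - enn2real (lower_variation M \<nu> A)"
proof -
  have *: "enn2real (upper_variation M \<nu> A) \<le> \<nu> A + enn2real (lower_variation M \<nu> A)"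
    if sm: "signed_measure M \<nu>" and fin: "lower_variation M \<nu> A < \<infinity>" for \<nu>
  proof -
    have "ennreal (- \<nu> A) \<le> lower_variation M \<nu> A"
      unfolding lower_variation_def using A by (intro upper_variation_upper) auto
    then have "- \<nu> A \<le> enn2real (lower_variation M \<nu> A)"
      using fin by (metis enn2real_mono enn2real_nonneg enn2real_ennreal infinity_ennreal_def
          linorder_linear order_trans)
    then have "enn2real (ennreal (\<nu> A + enn2real (lower_variation M \<nu> A)))
        = \<nu> A + enn2real (lower_variation M \<nu> A)" by simp
    with enn2real_mono[OF upper_variation_le[OF sm A fin]] show ?thesis by simp
  qed
  have swap: "lower_variation M (\<lambda>B. - \<nu> B) = upper_variation M \<nu>"
    "upper_variation M (\<lambda>B. - \<nu> B) = lower_variation M \<nu>"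
    by (simp_all add: lower_variation_def)
  show ?thesis
    using *[OF sm fin(2)] *[OF signed_measure_uminus[OF sm]] fin(1) by (simp add: swap)
qed

text \<open>
  The distributional derivative of the distribution function \<open>s \<mapsto> \<nu> {a<..s}\<close> is \<open>\<nu>\<close>. Both
  inclusions of the theorem rest on this formula.
\<close>

lemma signed_integral_test_function:
  fixes \<nu> :: "real set \<Rightarrow> real"
  assumes sm: "signed_measure (borel_interval a b) \<nu>"
    and fin: "total_variation (borel_interval a b) \<nu> {a<..<b} < \<infinity>"
  shows "integrable lborel (\<lambda>s. indicator {a<..<b} s * \<nu> {a<..s})" (is ?int)
    and "test_function a b \<phi> \<Longrightarrow>
      signed_integral (borel_interval a b) \<nu> \<phi>
        = - (\<integral>s. deriv \<phi> s * (indicator {a<..<b} s * \<nu> {a<..s}) \<partial>lborel)"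
proof -
  let ?M = "borel_interval a b"
  let ?p = "pos_part_measure ?M \<nu>" and ?n = "neg_part_measure ?M \<nu>"
  have sets: "sets ?p = sets ?M" "sets ?n = sets ?M"
    by (simp_all only: pos_part_measure_def neg_part_measure_def
        sets_measure_of[OF sets.space_closed] sets.sigma_sets_eq)
  have space: "space ?p = {a<..<b}" "space ?n = {a<..<b}"
    by (simp_all add: pos_part_measure_def neg_part_measure_def space_measure_of_conv
        space_borel_interval)
  have top: "{a<..<b} \<in> sets ?M" by (simp add: sets_borel_interval)
  have finite: "upper_variation ?M \<nu> {a<..<b} < \<infinity>" "lower_variation ?M \<nu> {a<..<b} < \<infinity>"
    using fin by (auto simp: total_variation_def)
  have fm: "finite_measure ?p" "finite_measure ?n"
    using finite emeasure_pos_part_measure[OF sm top] emeasure_neg_part_measure[OF sm top]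
    by (auto intro!: finite_measureI simp: space)
  have \<nu>: "\<nu> A = measure ?p A - measure ?n A" if A: "A \<in> sets ?M" for A
  proof -
    have "A \<subseteq> {a<..<b}" using A by (simp add: sets_borel_interval)
    then have "upper_variation ?M \<nu> A < \<infinity>" "lower_variation ?M \<nu> A < \<infinity>"
      using finite upper_variation_mono[of A "{a<..<b}"] unfolding lower_variation_def
      by (meson order_le_less_trans)+
    then show ?thesis
      using Jordan_decomposition[OF sm A] A sm
      by (simp add: measure_def emeasure_pos_part_measure emeasure_neg_part_measure)
  qed
  have \<nu>_Ioc: "indicator {a<..<b} s * \<nu> {a<..s}
      = indicator {a<..<b} s * measure ?p {a<..s} - indicator {a<..<b} s * measure ?n {a<..s}" for s
  proof (cases "s \<in> {a<..<b}")
    case True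
    then have "{a<..s} \<in> sets ?M" by (auto simp: sets_borel_interval)
    then show ?thesis using \<nu> by (simp add: right_diff_distrib)
  qed simp
  show ?int
    unfolding \<nu>_Ioc
    using Fubini_distribution_function(1)[OF fm(1) sets(1), of "\<lambda>_. 1" 1]
      Fubini_distribution_function(1)[OF fm(2) sets(2), of "\<lambda>_. 1" 1]
    by (intro Bochner_Integration.integrable_diff) auto
  assume \<phi>: "test_function a b \<phi>"
  show "signed_integral ?M \<nu> \<phi>
      = - (\<integral>s. deriv \<phi> s * (indicator {a<..<b} s * \<nu> {a<..s}) \<partial>lborel)"
    unfolding \<nu>_Ioc signed_integral_def right_diff_distrib
      integral_test_function(2)[OF fm(1) sets(1) \<phi>] integral_test_function(2)[OF fm(2) sets(2) \<phi>]
    using integral_test_function(1)[OF fm(1) sets(1) \<phi>] integral_test_function(1)[OF fm(2) sets(2) \<phi>]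
    by simp
qed

section \<open>Variation along chains\<close>

definition chain :: "real set \<Rightarrow> nat \<Rightarrow> (nat \<Rightarrow> real) \<Rightarrow> bool" where
  "chain S n x \<longleftrightarrow> (\<forall>i\<le>n. x i \<in> S) \<and> (\<forall>i<n. x i < x (Suc i))"

definition chain_sum :: "(real \<Rightarrow> real) \<Rightarrow> nat \<Rightarrow> (nat \<Rightarrow> real) \<Rightarrow> real" where
  "chain_sum f n x = (\<Sum>i=1..n. \<bar>f (x i) - f (x (i - 1))\<bar>)"

lemma chain_sum_le_variation_on: "chain S n x \<Longrightarrow> ennreal (chain_sum f n x) \<le> variation_on f S"
  unfolding variation_on_def chain_def chain_sum_def
  by (rule SUP_upper2[of "(n, x)"]) auto

lemma variation_on_leI:
  "(\<And>n x. chain S n x \<Longrightarrow> ennreal (chain_sum f n x) \<le> C) \<Longrightarrow> variation_on f S \<le> C"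
  unfolding variation_on_def chain_def chain_sum_def by (rule SUP_least) auto

lemma chain_snoc:
  assumes "chain S n x" "S \<subseteq> T" "y \<in> T" "x n < y"
  shows "chain T (Suc n) (x(Suc n := y))"
    and "chain_sum f (Suc n) (x(Suc n := y)) = chain_sum f n x + \<bar>f y - f (x n)\<bar>"
proof -
  show "chain T (Suc n) (x(Suc n := y))"
    using assms unfolding chain_def by (auto simp: le_Suc_eq less_Suc_eq)
  have "(\<Sum>i=1..n. \<bar>f ((x(Suc n := y)) i) - f ((x(Suc n := y)) (i - 1))\<bar>) = chain_sum f n x"
    unfolding chain_sum_def by (intro sum.cong) auto
  then show "chain_sum f (Suc n) (x(Suc n := y)) = chain_sum f n x + \<bar>f y - f (x n)\<bar>"
    unfolding chain_sum_def by simp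
qed

lemma variation_on_mono: "S \<subseteq> T \<Longrightarrow> variation_on f S \<le> variation_on f T"
  by (intro variation_on_leI chain_sum_le_variation_on) (auto simp: chain_def)

text \<open>
  A chain sum of \<open>f\<close> is dominated by the corresponding sum of increments of \<open>T\<close>, which telescopes.
\<close>

lemma variation_on_le:
  assumes incr: "\<And>x y. x \<in> S \<Longrightarrow> y \<in> S \<Longrightarrow> x < y \<Longrightarrow> \<bar>f y - f x\<bar> \<le> T y - T x"
    and bounds: "\<And>x. x \<in> S \<Longrightarrow> 0 \<le> T x" "\<And>x. x \<in> S \<Longrightarrow> T x \<le> C"
  shows "variation_on f S \<le> ennreal C"
proof (rule variation_on_leI, rule ennreal_leI)
  fix n x assume "chain S n x"
  then have x: "\<forall>i\<le>n. x i \<in> S" "\<forall>i<n. x i < x (Suc i)"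
    by (auto simp: chain_def)
  have "chain_sum f n x \<le> (\<Sum>i=1..n. T (x i) - T (x (i - 1)))"
    unfolding chain_sum_def
  proof (rule sum_mono)
    fix i assume "i \<in> {1..n}"
    then obtain j where "i = Suc j" "j < n" by (cases i) auto
    then show "\<bar>f (x i) - f (x (i - 1))\<bar> \<le> T (x i) - T (x (i - 1))"
      using x incr[of "x j" "x i"] by auto
  qed
  also have "\<dots> = T (x n) - T (x 0)"
    using sum_telescope''[of 0 n "\<lambda>i. T (x i)"] by simp
  also have "\<dots> \<le> C" using bounds x by (smt (verit) le_refl zero_le)
  finally show "chain_sum f n x \<le> C" .
qed

text \<open>
  A chain in \<open>S \<inter> {..x}\<close> may be assumed to end in \<open>x\<close>, because adding \<open>x\<close> does not decrease its sum;
  it can then be prolonged to \<open>y\<close>. In terms of the variation \<open>v\<close> up to a point, this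
  superadditivity says that \<open>v + f\<close> and \<open>v - f\<close> are increasing.
\<close>

lemma variation_on_increment:
  assumes fin: "variation_on f (S \<inter> {..y}) < \<infinity>" and xy: "x \<in> S" "y \<in> S" "x < y"
  shows "enn2real (variation_on f (S \<inter> {..x})) + \<bar>f y - f x\<bar> \<le> enn2real (variation_on f (S \<inter> {..y}))"
proof -
  let ?C = "enn2real (variation_on f (S \<inter> {..y})) - \<bar>f y - f x\<bar>"
  have *: "chain_sum f n z \<le> ?C" if z: "chain (S \<inter> {..x}) n z" "z n = x" for n z
  proof -
    have "chain (S \<inter> {..y}) (Suc n) (z(Suc n := y))"
      using xy z by (intro chain_snoc(1)[OF z(1)]) auto
    from chain_sum_le_variation_on[OF this]
    have "ennreal (chain_sum f n z + \<bar>f y - f x\<bar>) \<le> variation_on f (S \<inter> {..y})"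
      using chain_snoc(2)[OF z(1), of UNIV y] xy z(2) by simp
    then have "enn2real (ennreal (chain_sum f n z + \<bar>f y - f x\<bar>)) \<le> enn2real (variation_on f (S \<inter> {..y}))"
      using fin by (intro enn2real_mono) auto
    moreover have "0 \<le> chain_sum f n z" unfolding chain_sum_def by (intro sum_nonneg) auto
    then have "enn2real (ennreal (chain_sum f n z + \<bar>f y - f x\<bar>)) = chain_sum f n z + \<bar>f y - f x\<bar>"
      by (intro enn2real_ennreal) simp
    ultimately show ?thesis by linarith
  qed
  have "variation_on f (S \<inter> {..x}) \<le> ennreal ?C"
  proof (rule variation_on_leI, rule ennreal_leI)
    fix n z assume z: "chain (S \<inter> {..x}) n z"
    then have "z n \<le> x" by (auto simp: chain_def)
    show "chain_sum f n z \<le> ?C"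
    proof (cases "z n = x")
      case True
      with z show ?thesis by (rule *)
    next
      case False
      then have "z n < x" using \<open>z n \<le> x\<close> by simp
      note snoc = chain_snoc[OF z order_refl _ this]
      have "chain_sum f n z \<le> chain_sum f (Suc n) (z(Suc n := x))"
        using snoc(2) xy by simp
      also have "\<dots> \<le> ?C" using snoc(1) xy by (intro *) auto
      finally show ?thesis .
    qed
  qed
  moreover have "0 \<le> ?C"
    using *[of 0 "\<lambda>_. x"] xy by (simp add: chain_def chain_sum_def)
  ultimately have "enn2real (variation_on f (S \<inter> {..x})) \<le> ?C" by (intro enn2real_leI)
  then show ?thesis by simp
qed

section \<open>Functions with a measure as derivative have bounded variation\<close>

lemma null_sets_lebesgue_iff_AE: "M \<in> null_sets lebesgue \<longleftrightarrow> (AE x in lborel. x \<notin> M)"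
  unfolding null_sets_completion_iff2 eventually_ae_filter by auto

lemma borel_representative:
  fixes f :: "real \<Rightarrow> real"
  assumes "set_integrable lebesgue {a<..<b} f"
  obtains g where "integrable lborel g" "AE x in lborel. g x = indicator {a<..<b} x * f x"
    and "\<And>h. h \<in> borel_measurable borel \<Longrightarrow>
      (LINT x:{a<..<b}|lebesgue. f x * h x) = (\<integral>x. g x * h x \<partial>lborel)"
proof -
  let ?u = "\<lambda>x. indicator {a<..<b} x *\<^sub>R f x"
  have u: "integrable lebesgue ?u" using assms by (simp add: set_integrable_def)
  obtain g where g: "g \<in> borel_measurable lborel" and ae: "AE x in lborel. ?u x = g x"
    using completion_ex_borel_measurable_real[OF borel_measurable_integrable[OF u]] by auto
  have g': "g \<in> borel_measurable lebesgue" using g by (rule measurable_completion)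
  have ae': "AE x in lebesgue. ?u x = g x" using ae by (rule AE_completion)
  have "integrable lebesgue g"
    using u integrable_cong_AE[OF borel_measurable_integrable[OF u] g' ae'] by blast
  then have "integrable lborel g" using integrable_completion[OF g] by blast
  moreover have "AE x in lborel. g x = indicator {a<..<b} x * f x"
    using ae by eventually_elim simp
  moreover have "(LINT x:{a<..<b}|lebesgue. f x * h x) = (\<integral>x. g x * h x \<partial>lborel)"
    if h: "h \<in> borel_measurable borel" for h
  proof -
    have h': "h \<in> borel_measurable lborel" using h by simp
    have "(LINT x:{a<..<b}|lebesgue. f x * h x) = (\<integral>x. ?u x * h x \<partial>lebesgue)"
      by (simp add: set_lebesgue_integral_def mult.assoc)
    also have "\<dots> = (\<integral>x. g x * h x \<partial>lebesgue)"
    proof (rule integral_cong_AE)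
      show "AE x in lebesgue. ?u x * h x = g x * h x" using ae' by eventually_elim simp
    qed (use borel_measurable_integrable[OF u] g' measurable_completion[OF h'] in auto)
    also have "\<dots> = (\<integral>x. g x * h x \<partial>lborel)"
      using g h' by (intro integral_completion) auto
    finally show ?thesis .
  qed
  ultimately show ?thesis by (rule that)
qed

text \<open>
  The increments of \<open>f\<close> are differences of increments of the distribution functions of the two parts of
  \<open>\<nu>\<close>, which are increasing and bounded by the total masses.
\<close>

lemma variation_on_distribution_function:
  assumes sm: "signed_measure (borel_interval a b) \<nu>"
    and fin: "total_variation (borel_interval a b) \<nu> {a<..<b} < \<infinity>"
    and S: "S \<subseteq> {a<..<b}" and f: "\<And>x. x \<in> S \<Longrightarrow> f x = \<nu> {a<..x} + K"
  shows "variation_on f S < \<infinity>"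
proof -
  let ?M = "borel_interval a b"
  let ?U = "upper_variation ?M \<nu>" and ?L = "lower_variation ?M \<nu>"
  let ?p = "\<lambda>s. enn2real (?U {a<..s})" and ?n = "\<lambda>s. enn2real (?L {a<..s})"
  have finite: "?U {a<..<b} < \<infinity>" "?L {a<..<b} < \<infinity>"
    using fin by (auto simp: total_variation_def)
  have mono: "A \<subseteq> B \<Longrightarrow> ?U A \<le> ?U B" "A \<subseteq> B \<Longrightarrow> ?L A \<le> ?L B" for A B
    unfolding lower_variation_def by (rule upper_variation_mono; assumption)+
  have fin_Ioc: "?U {a<..s} < \<infinity>" "?L {a<..s} < \<infinity>" if "s \<in> S" for s
  proof -
    have "{a<..s} \<subseteq> {a<..<b}" using S that by auto
    then show "?U {a<..s} < \<infinity>" "?L {a<..s} < \<infinity>"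
      using finite mono by (meson order_le_less_trans)+
  qed
  have f_eq: "f s = ?p s - ?n s + K" if "s \<in> S" for s
  proof -
    have "{a<..s} \<in> sets ?M" using S that by (auto simp: sets_borel_interval)
    then show ?thesis using Jordan_decomposition[OF sm _ fin_Ioc[OF that]] f that by simp
  qed
  have "variation_on f S \<le> ennreal (enn2real (?U {a<..<b}) + enn2real (?L {a<..<b}))"
  proof (rule variation_on_le[where T = "\<lambda>s. ?p s + ?n s"])
    fix x y assume xy: "x \<in> S" "y \<in> S" "x < y"
    then have "?p x \<le> ?p y" "?n x \<le> ?n y"
      using fin_Ioc by (auto intro!: enn2real_mono mono)
    then show "\<bar>f y - f x\<bar> \<le> (?p y + ?n y) - (?p x + ?n x)"
      using xy by (simp add: f_eq)
  next
    fix x assume "x \<in> S"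
    then have "{a<..x} \<subseteq> {a<..<b}" using S by auto
    then show "?p x + ?n x \<le> enn2real (?U {a<..<b}) + enn2real (?L {a<..<b})"
      using finite by (intro add_mono enn2real_mono mono) auto
  qed simp
  then show ?thesis by (rule order_le_less_trans) simp
qed

text \<open>
  The distribution function \<open>F\<close> of \<open>Df\<close> has the same weak derivative as \<open>f\<close>, so \<open>f\<close> and \<open>F\<close> differ by a
  constant outside a null set. This set is the exceptional set for Cesari's condition.
\<close>

lemma BVL1_subset_BVC:
  assumes ab: "a < b"
  shows "BVL1 a b \<subseteq> BVC a b"
proof
  fix f assume "f \<in> BVL1 a b"
  then obtain \<nu> where int: "set_integrable lebesgue {a<..<b} f"
    and radon: "finite_signed_radon_measure a b \<nu>"
    and weak: "\<And>\<phi>. test_function a b \<phi> \<Longrightarrow> (LINT x:{a<..<b}|lebesgue. f x * deriv \<phi> x)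
      = - signed_integral (borel_interval a b) \<nu> \<phi>"
    unfolding BVL1_def by blast
  have sm: "signed_measure (borel_interval a b) \<nu>"
    and fin: "total_variation (borel_interval a b) \<nu> {a<..<b} < \<infinity>"
    using radon unfolding finite_signed_radon_measure_def by auto
  let ?F = "\<lambda>s. indicator {a<..<b} s * \<nu> {a<..s}"
  obtain g where g: "integrable lborel g" "AE x in lborel. g x = indicator {a<..<b} x * f x"
    and gh: "\<And>h. h \<in> borel_measurable borel \<Longrightarrow>
      (LINT x:{a<..<b}|lebesgue. f x * h x) = (\<integral>x. g x * h x \<partial>lborel)"
    using borel_representative[OF int] by blast
  have F: "integrable lborel ?F" by (rule signed_integral_test_function(1)[OF sm fin])
  have "(\<integral>x. (g x - ?F x) * deriv \<phi> x \<partial>lborel) = 0" if \<phi>: "test_function a b \<phi>" for \<phi>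
  proof -
    have "(\<integral>x. g x * deriv \<phi> x \<partial>lborel) = - signed_integral (borel_interval a b) \<nu> \<phi>"
      using weak[OF \<phi>] gh[OF borel_measurable_deriv_test_function[OF \<phi>]] by simp
    also have "\<dots> = (\<integral>x. ?F x * deriv \<phi> x \<partial>lborel)"
      using signed_integral_test_function(2)[OF sm fin \<phi>] by (simp add: ac_simps)
    finally show ?thesis
      using integrable_mult_deriv_test_function[OF \<phi> g(1)]
        integrable_mult_deriv_test_function[OF \<phi> F] by (simp add: left_diff_distrib)
  qed
  then obtain K where K: "AE x in lborel. x \<in> {a<..<b} \<longrightarrow> g x - ?F x = K"
    using du_Bois_Reymond[OF ab, of "\<lambda>x. g x - ?F x"] g(1) F by auto
  define M where "M = {x \<in> {a<..<b}. f x \<noteq> \<nu> {a<..x} + K}"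
  have "AE x in lborel. x \<notin> M"
    using K g(2) by eventually_elim (auto simp: M_def)
  then have "M \<in> null_sets lebesgue"
    by (simp add: null_sets_lebesgue_iff_AE)
  moreover have "variation_on f ({a<..<b} - M) < \<infinity>"
    by (rule variation_on_distribution_function[OF sm fin, of _ _ K]) (auto simp: M_def)
  moreover have "M \<subseteq> {a<..<b}" by (auto simp: M_def)
  ultimately show "f \<in> BVC a b"
    using int unfolding BVC_def by (intro CollectI conjI exI[of _ M])
qed

section \<open>Monotone functions as distribution functions\<close>

text \<open>
  Stieltjes measures require a right-continuous function. Replacing a monotone function by its right
  limits changes it only where it is discontinuous, that is, at countably many points.
\<close>

lemma mono_right_limit:
  fixes q :: "real \<Rightarrow> real"
  assumes "mono q"
  obtains G where "mono G" "\<And>x. continuous (at_right x) G" "\<And>x. isCont q x \<Longrightarrow> G x = q x"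
proof -
  have mono: "q x \<le> q y" if "x < y" for x y
    using monoD[OF assms, of x y] that by simp
  define G where "G x = (INF y\<in>{x<..}. q y)" for x
  have bdd: "bdd_below (q ` {x<..})" for x
    by (rule bdd_belowI2[of _ "q x"]) (simp_all add: mono)
  have le: "G x \<le> q y" if "x < y" for x y
    unfolding G_def using that by (intro cINF_lower bdd) auto
  have ge: "q x \<le> G x" for x
    unfolding G_def by (intro cINF_greatest) (simp_all add: mono)
  have G: "mono G"
    unfolding G_def by (intro monoI cINF_superset_mono bdd) auto
  moreover have "continuous (at_right x) G" for x
    unfolding continuous_within
  proof (rule order_tendstoI)
    fix l assume "l < G x"
    moreover have "G x \<le> G y" if "x < y" for y
      using monoD[OF G, of x y] that by simp
    ultimately have "l < G y" if "x < y" for y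
      using that by (meson less_le_trans)
    then show "\<forall>\<^sub>F y in at_right x. l < G y"
      by (auto simp: eventually_at_filter)
  next
    fix u assume "G x < u"
    then obtain y where y: "x < y" "q y < u"
      unfolding G_def by (subst (asm) cINF_less_iff) (auto simp: bdd)
    have "\<forall>\<^sub>F z in at_right x. z < y"
      using y(1) by (auto simp: eventually_at_right_field)
    then show "\<forall>\<^sub>F z in at_right x. G z < u"
      by eventually_elim (metis le y(2) le_less_trans)
  qed
  moreover have "G x = q x" if "isCont q x" for x
  proof (rule antisym[OF _ ge])
    have "(q \<longlongrightarrow> q x) (at_right x)"
      using that by (simp add: isCont_def filterlim_at_split)
    then show "G x \<le> q x"
      by (rule tendsto_lowerbound) (use le in \<open>auto simp: eventually_at_filter\<close>)
  qed
  ultimately show ?thesis by (rule that)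
qed

text \<open>
  Left of \<open>S\<close> the supremum of the values of \<open>p\<close> would be taken over the empty set; the lower bound
  \<open>- B\<close> of \<open>p\<close> is thrown in as a default value.
\<close>

lemma monotone_extension:
  fixes p :: "real \<Rightarrow> real"
  assumes p: "mono_on S p" and bound: "\<And>x. x \<in> S \<Longrightarrow> \<bar>p x\<bar> \<le> B"
  obtains q where "mono q" "\<And>x. x \<in> S \<Longrightarrow> q x = p x"
proof -
  define q where "q x = Sup (insert (- B) (p ` (S \<inter> {..x})))" for x
  have bdd: "bdd_above (insert (- B) (p ` (S \<inter> {..x})))" for x
    using bound by (intro bdd_aboveI[of _ "max (- B) B"]) (fastforce simp: max_def)
  have "mono q"
    unfolding q_def by (intro monoI cSup_subset_mono bdd) auto
  moreover have "q x = p x" if "x \<in> S" for x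
    unfolding q_def
  proof (rule cSup_eq_maximum)
    fix t assume "t \<in> insert (- B) (p ` (S \<inter> {..x}))"
    then show "t \<le> p x"
      using bound[OF that] p that by (auto dest: mono_onD)
  qed (use that in auto)
  ultimately show ?thesis by (rule that)
qed

text \<open>
  The measure is the Stieltjes measure of the right-continuous version of a monotone extension of \<open>p\<close>;
  the constant is the value of that version at \<open>a\<close>.
\<close>

lemma monotone_eq_distribution_function:
  fixes p :: "real \<Rightarrow> real"
  assumes ab: "a < b" and S: "S \<subseteq> {a<..<b}"
    and p: "mono_on S p" and bound: "\<And>x. x \<in> S \<Longrightarrow> \<bar>p x\<bar> \<le> B"
  obtains \<mu> c where "finite_measure \<mu>" "sets \<mu> = sets (borel_interval a b)"
    "AE x in lborel. x \<in> S \<longrightarrow> measure \<mu> {a<..x} = p x - c"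
proof -
  obtain q where q: "mono q" "\<And>x. x \<in> S \<Longrightarrow> q x = p x"
    using monotone_extension[OF p bound] by blast
  obtain G where G: "mono G" "\<And>x. continuous (at_right x) G" "\<And>x. isCont q x \<Longrightarrow> G x = q x"
    using mono_right_limit[OF q(1)] by blast
  let ?I = "interval_measure G"
  define \<mu> where "\<mu> = restrict_space ?I {a<..<b}"
  have Ioc: "emeasure ?I {x<..y} = ennreal (G y - G x)" if "x \<le> y" for x y
    using that G(2) monoD[OF G(1)] by (intro emeasure_interval_measure_Ioc) auto
  have sets: "sets \<mu> = sets (borel_interval a b)"
    unfolding \<mu>_def by (intro sets_restrict_space_cong) simp
  have "emeasure ?I {a<..<b} \<le> emeasure ?I {a<..b}" by (intro emeasure_mono) auto
  also have "\<dots> < \<infinity>" using ab by (simp add: Ioc)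
  finally have fm: "finite_measure \<mu>"
    by (intro finite_measureI) (simp add: \<mu>_def space_restrict_space emeasure_restrict_space)
  have \<mu>_Ioc: "measure \<mu> {a<..x} = G x - G a" if "x \<in> {a<..<b}" for x
  proof -
    have "emeasure \<mu> {a<..x} = emeasure ?I {a<..x}"
      unfolding \<mu>_def using that by (intro emeasure_restrict_space) auto
    then show ?thesis using that Ioc[of a x] monoD[OF G(1), of a x] by (simp add: measure_def)
  qed
  have "AE x in lborel. x \<in> S \<longrightarrow> measure \<mu> {a<..x} = p x - G a"
  proof (rule AE_I')
    show "{x. \<not> isCont q x} \<in> null_sets lborel"
      using mono_ctble_discont[OF q(1)] by (rule countable_imp_null_set_lborel)
    show "{x \<in> space lborel. \<not> (x \<in> S \<longrightarrow> measure \<mu> {a<..x} = p x - G a)} \<subseteq> {x. \<not> isCont q x}"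
    proof clarsimp
      fix x assume "x \<in> S" "measure \<mu> {a<..x} \<noteq> p x - G a" "isCont q x"
      then show False using q(2)[of x] G(3)[of x] \<mu>_Ioc[of x] S by auto
    qed
  qed
  with fm sets show ?thesis by (rule that)
qed

section \<open>Functions of bounded variation have a measure as derivative\<close>

text \<open>
  Either part of the Jordan decomposition is bounded by the mass of the corresponding measure. Inner
  regularity is a general property of finite Borel measures on the line; it is applied to the total
  variation extended by zero outside \<open>{a<..<b}\<close>.
\<close>

lemma finite_signed_radon_measure_diff:
  assumes \<mu>: "finite_measure \<mu>\<^sub>1" "finite_measure \<mu>\<^sub>2"
    and sets: "sets \<mu>\<^sub>1 = sets (borel_interval a b)" "sets \<mu>\<^sub>2 = sets (borel_interval a b)"
  shows "finite_signed_radon_measure a b (\<lambda>A. measure \<mu>\<^sub>1 A - measure \<mu>\<^sub>2 A)"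
    (is "finite_signed_radon_measure a b ?\<nu>")
proof -
  interpret \<mu>1: finite_measure \<mu>\<^sub>1 by fact
  interpret \<mu>2: finite_measure \<mu>\<^sub>2 by fact
  let ?M = "borel_interval a b"
  let ?T = "total_variation ?M ?\<nu>"
  have sm: "signed_measure ?M ?\<nu>"
    unfolding signed_measure_def
    using \<mu>1.finite_measure_UNION \<mu>2.finite_measure_UNION by (auto simp: sets intro!: sums_diff)
  have "upper_variation ?M ?\<nu> A \<le> ennreal (measure \<mu>\<^sub>1 (space \<mu>\<^sub>1))" for A
    unfolding upper_variation_def
  proof (rule SUP_least, rule ennreal_leI)
    fix B
    show "?\<nu> B \<le> measure \<mu>\<^sub>1 (space \<mu>\<^sub>1)"
      using \<mu>1.bounded_measure[of B] measure_nonneg[of \<mu>\<^sub>2 B] by linarith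
  qed
  moreover have "lower_variation ?M ?\<nu> A \<le> ennreal (measure \<mu>\<^sub>2 (space \<mu>\<^sub>2))" for A
    unfolding lower_variation_def upper_variation_def
  proof (rule SUP_least, rule ennreal_leI)
    fix B
    show "- ?\<nu> B \<le> measure \<mu>\<^sub>2 (space \<mu>\<^sub>2)"
      using \<mu>2.bounded_measure[of B] measure_nonneg[of \<mu>\<^sub>1 B] by linarith
  qed
  ultimately have "?T A \<le> ennreal (measure \<mu>\<^sub>1 (space \<mu>\<^sub>1)) + ennreal (measure \<mu>\<^sub>2 (space \<mu>\<^sub>2))" for A
    unfolding total_variation_def by (rule add_mono)
  then have fin: "?T A < \<infinity>" for A
    by (rule order_le_less_trans) simp
  define N where "N = distr (measure_of (space ?M) (sets ?M) ?T) borel (\<lambda>x. x)"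
  have N: "emeasure N A = ?T (A \<inter> {a<..<b})" if A: "A \<in> sets borel" for A
  proof -
    let ?N = "measure_of (space ?M) (sets ?M) ?T"
    have ca: "countably_additive (sets ?M) ?T"
      using countably_additive_upper_variation[OF sm]
        countably_additive_upper_variation[OF signed_measure_uminus[OF sm]]
      unfolding countably_additive_def total_variation_def lower_variation_def
      by (simp add: suminf_add[symmetric])
    have pos: "positive (sets ?M) ?T"
      using upper_variation_empty[OF sm] upper_variation_empty[OF signed_measure_uminus[OF sm]]
      by (simp add: positive_def total_variation_def lower_variation_def)
    have setsN: "sets ?N = sets ?M"
      by (simp only: sets_measure_of[OF sets.space_closed] sets.sigma_sets_eq)
    have spaceN: "space ?N = {a<..<b}"
      by (simp only: space_measure_of[OF sets.space_closed]) (rule space_borel_interval)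
    have "(\<lambda>x. x) \<in> borel_measurable ?N"
      unfolding measurable_cong_sets[OF setsN refl] by (intro measurable_restrict_space1) auto
    then have "emeasure N A = emeasure ?N (A \<inter> {a<..<b})"
      unfolding N_def using A by (simp only: emeasure_distr vimage_ident spaceN)
    also have "\<dots> = ?T (A \<inter> {a<..<b})"
      using A by (intro emeasure_measure_of_sigma[OF _ pos ca] sets.sigma_algebra_axioms)
        (auto simp: sets_borel_interval)
    finally show ?thesis .
  qed
  have "?T A = (SUP K \<in> {K. compact K \<and> K \<subseteq> A}. ?T K)" if A: "A \<in> sets ?M" for A
  proof -
    have A': "A \<in> sets borel" "A \<subseteq> {a<..<b}" using A by (auto simp: sets_borel_interval)
    have "emeasure N A = (SUP K \<in> {K. K \<subseteq> A \<and> compact K}. emeasure N K)"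
      using N[of UNIV] fin by (intro inner_regular A') (auto simp: N_def less_top)
    also have "\<dots> = (SUP K \<in> {K. compact K \<and> K \<subseteq> A}. ?T K)"
    proof (rule SUP_cong)
      fix K assume "K \<in> {K. compact K \<and> K \<subseteq> A}"
      then have "K \<in> sets borel" "K \<inter> {a<..<b} = K" using A'(2) by (auto intro: borel_compact)
      then show "emeasure N K = ?T K" using N[of K] by simp
    qed auto
    finally show ?thesis using N[OF A'(1)] A'(2) by (simp add: Int_absorb2)
  qed
  with sm fin show ?thesis unfolding finite_signed_radon_measure_def by auto
qed

text \<open>
  Outside the exceptional set \<open>f = v - (v - f)\<close> is a difference of two bounded increasing functions,
  where \<open>v x\<close> is the variation of \<open>f\<close> up to \<open>x\<close>. Up to constants these are distribution functions of
  finite measures almost everywhere, and the difference of the measures is the derivative of \<open>f\<close>.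
\<close>

lemma BVC_subset_BVL1:
  assumes ab: "a < b"
  shows "BVC a b \<subseteq> BVL1 a b"
proof
  fix f assume "f \<in> BVC a b"
  then obtain M where int: "set_integrable lebesgue {a<..<b} f"
    and M: "M \<in> null_sets lebesgue" and var: "variation_on f ({a<..<b} - M) < \<infinity>"
    unfolding BVC_def by blast
  define S where "S = {a<..<b} - M"
  define v where "v x = enn2real (variation_on f (S \<inter> {..x}))" for x
  define V where "V = enn2real (variation_on f S)"
  have fin: "variation_on f (S \<inter> {..x}) < \<infinity>" for x
    using variation_on_mono[of "S \<inter> {..x}" S f] var by (auto simp: S_def intro: order_le_less_trans)
  have v_bounds: "0 \<le> v x" "v x \<le> V" for x
    using variation_on_mono[of "S \<inter> {..x}" S f] var
    by (auto simp: S_def v_def V_def intro!: enn2real_mono)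
  have incr: "v x + \<bar>f y - f x\<bar> \<le> v y" if "x \<in> S" "y \<in> S" "x < y" for x y
    unfolding v_def using variation_on_increment[OF fin that] .
  obtain B where B: "\<And>x. x \<in> S \<Longrightarrow> \<bar>f x\<bar> \<le> B"
  proof (cases "S = {}")
    case False
    then obtain x0 where x0: "x0 \<in> S" by blast
    have "\<bar>f x\<bar> \<le> \<bar>f x0\<bar> + V" if "x \<in> S" for x
      using incr[OF that x0] incr[OF x0 that] v_bounds[of x] v_bounds[of x0] 
      by (cases x x0 rule: linorder_cases) auto
    then show ?thesis by (rule that)
  qed (use that in auto)
  have S: "S \<subseteq> {a<..<b}" by (auto simp: S_def)
  have "mono_on S v"
  proof (rule mono_onI)
    fix x y assume "x \<in> S" "y \<in> S" "x \<le> y"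
    then show "v x \<le> v y" using incr[of x y] by (cases "x = y") auto
  qed
  moreover have "\<bar>v x\<bar> \<le> V" for x using v_bounds[of x] by simp
  ultimately obtain \<mu>\<^sub>1 c\<^sub>1 where \<mu>1: "finite_measure \<mu>\<^sub>1" "sets \<mu>\<^sub>1 = sets (borel_interval a b)"
    "AE x in lborel. x \<in> S \<longrightarrow> measure \<mu>\<^sub>1 {a<..x} = v x - c\<^sub>1"
    using monotone_eq_distribution_function[OF ab S] by blast
  have "mono_on S (\<lambda>x. v x - f x)"
  proof (rule mono_onI)
    fix x y assume "x \<in> S" "y \<in> S" "x \<le> y"
    then show "v x - f x \<le> v y - f y" using incr[of x y] by (cases "x = y") auto
  qed
  moreover have "\<bar>v x - f x\<bar> \<le> V + B" if "x \<in> S" for x using v_bounds[of x] B[OF that] by linarith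
  ultimately obtain \<mu>\<^sub>2 c\<^sub>2 where \<mu>2: "finite_measure \<mu>\<^sub>2" "sets \<mu>\<^sub>2 = sets (borel_interval a b)"
    "AE x in lborel. x \<in> S \<longrightarrow> measure \<mu>\<^sub>2 {a<..x} = (v x - f x) - c\<^sub>2"
    using monotone_eq_distribution_function[OF ab S, of "\<lambda>x. v x - f x"] by blast
  define \<nu> where "\<nu> = (\<lambda>A. measure \<mu>\<^sub>1 A - measure \<mu>\<^sub>2 A)"
  have radon: "finite_signed_radon_measure a b \<nu>"
    unfolding \<nu>_def by (rule finite_signed_radon_measure_diff[OF \<mu>1(1) \<mu>2(1) \<mu>1(2) \<mu>2(2)])
  then have sm: "signed_measure (borel_interval a b) \<nu>"
    and tv: "total_variation (borel_interval a b) \<nu> {a<..<b} < \<infinity>"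
    unfolding finite_signed_radon_measure_def by auto
  let ?F = "\<lambda>s. indicator {a<..<b} s * \<nu> {a<..s}"
  have F: "integrable lborel ?F" by (rule signed_integral_test_function(1)[OF sm tv])
  obtain g where g: "integrable lborel g" "AE x in lborel. g x = indicator {a<..<b} x * f x"
    and gh: "\<And>h. h \<in> borel_measurable borel \<Longrightarrow>
      (LINT x:{a<..<b}|lebesgue. f x * h x) = (\<integral>x. g x * h x \<partial>lborel)"
    using borel_representative[OF int] by blast
  have "(LINT x:{a<..<b}|lebesgue. f x * deriv \<phi> x) = - signed_integral (borel_interval a b) \<nu> \<phi>"
    if \<phi>: "test_function a b \<phi>" for \<phi>
  proof -
    let ?c = "c\<^sub>1 - c\<^sub>2" and ?I = "\<lambda>x. indicator {a<..<b} x :: real"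
    have I: "integrable lborel ?I" by (simp add: emeasure_lborel_Ioo_finite[simplified])
    have "AE x in lborel. x \<notin> M" using M by (simp add: null_sets_lebesgue_iff_AE)
    then have ae: "AE x in lborel. g x = ?F x + ?c * ?I x"
      using g(2) \<mu>1(3) \<mu>2(3)
      by eventually_elim (auto simp: \<nu>_def S_def indicator_def)
    note meas [measurable] = borel_measurable_deriv_test_function[OF \<phi>]
      borel_measurable_integrable[OF F] borel_measurable_integrable[OF g(1)]
    have "(LINT x:{a<..<b}|lebesgue. f x * deriv \<phi> x) = (\<integral>x. g x * deriv \<phi> x \<partial>lborel)"
      by (intro gh borel_measurable_deriv_test_function[OF \<phi>])
    also have "\<dots> = (\<integral>x. (?F x + ?c * ?I x) * deriv \<phi> x \<partial>lborel)"
    proof (rule integral_cong_AE)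
      show "AE x in lborel. g x * deriv \<phi> x = (?F x + ?c * ?I x) * deriv \<phi> x"
        using ae by eventually_elim simp
      show "(\<lambda>x. (?F x + ?c * ?I x) * deriv \<phi> x) \<in> borel_measurable lborel"
        by (intro borel_measurable_times borel_measurable_add meas) auto
    qed measurable
    also have "\<dots> = (\<integral>x. ?F x * deriv \<phi> x + ?c * (?I x * deriv \<phi> x) \<partial>lborel)"
      by (intro Bochner_Integration.integral_cong) (simp_all only: algebra_simps)
    also have "\<dots> = (\<integral>x. ?F x * deriv \<phi> x \<partial>lborel) + ?c * (\<integral>x. ?I x * deriv \<phi> x \<partial>lborel)"
      using integrable_mult_deriv_test_function[OF \<phi> F] integrable_mult_deriv_test_function[OF \<phi> I]
      by (subst Bochner_Integration.integral_add) simp_all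
    \<comment> \<open>The additive constant is invisible to derivatives of test functions.\<close>
    also have "(\<integral>x. ?I x * deriv \<phi> x \<partial>lborel) = (\<integral>x. indicator {a..<b} x * deriv \<phi> x \<partial>lborel)"
      using AE_lborel_singleton[of a] meas(1)
      by (intro integral_cong_AE) (auto simp: indicator_def elim!: eventually_mono)
    also have "\<dots> = 0"
      using integral_deriv_test_function[OF \<phi> ab] test_functionD(2)[OF \<phi>, of a] by simp
    finally show ?thesis
      using signed_integral_test_function(2)[OF sm tv \<phi>] by (simp add: ac_simps)
  qed
  with int radon show "f \<in> BVL1 a b"
    unfolding BVL1_def by blast
qed

theorem mainTheorem1:
  fixes a b :: real
  assumes "a < b"
  shows "BVC a b = BVL1 a b"
  using BVC_subset_BVL1[OF assms] BVL1_subset_BVC[OF assms] by (rule equalityI)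

end
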